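(* Fix $\rho\in(0,1)$. Let $f:\{0,1\}^n\times\{0,1\}^n\to\{0,1\}$ be a total strongly permutation-invariant function with $\mathrm{R}(f)=k$. Then $\mathrm{ISR}_\rho(f)\le \tilde O(k^2)$ and $\mathrm{ISR}^{\text{1-way}}_\rho(f)\le \tilde O(k^3)$, where $\tilde O$ hides factors polylogarithmic in $k$ and the bounds do not depend on $n$.
   Context: A total function $f:\{0,1\}^n\times\{0,1\}^n\to\{0,1\}$ is strongly permutation-invariant if there exist a symmetric function $\sigma:\{0,1\}^n\to\{0,1\}$ and a function $h:\{0,1\}^2\to\{0,1\}$ such that $f(\mathbf{x},\mathbf{y})=\sigma(h(x_1,y_1),\dots,h(x_n,y_n))$ for all $\mathbf{x},\mathbf{y}$. $\mathrm{R}(f)$ is the public-coin two-way randomized communication complexity with success probability $\ge 2/3$ on every input. $\mathrm{ISR}_\rho(f)$ (resp. $\mathrm{ISR}^{\text{1-way}}_\rho(f)$) is the two-way (resp. one-way, Alice to Bob) communication complexity with success probability $\ge 2/3$ on every input when, instead of public randomness, Alice gets $r_1,r_2,\dots$ and Bob gets $s_1,s_2,\dots$ with the pairs $(r_i,s_i)$ i.i.d., $r_i,s_i$ uniform on $\{0,1\}$ and $\Pr[r_i=s_i]=(1+\rho)/2$. *)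

theory Defs
  imports "HOL-Probability.Probability" "HOL-Combinatorics.Permutations"
begin

text \<open>Elements of \<open>{0,1}\<^sup>n\<close> are Boolean lists of length \<open>n\<close>; functions on \<open>{0,1}\<^sup>n\<close> are total functions
  on lists of which only the values on lists of length \<open>n\<close> are ever used.\<close>

definition symmetric_fn :: "nat \<Rightarrow> (bool list \<Rightarrow> bool) \<Rightarrow> bool" where
  "symmetric_fn n \<sigma> \<longleftrightarrow>
    (\<forall>p z. p permutes {..<n} \<and> length z = n \<longrightarrow> \<sigma> (permute_list p z) = \<sigma> z)"

definition strongly_perm_invariant :: "nat \<Rightarrow> (bool list \<Rightarrow> bool list \<Rightarrow> bool) \<Rightarrow> bool" where
  "strongly_perm_invariant n f \<longleftrightarrow>
    (\<exists>\<sigma> h. symmetric_fn n \<sigma> \<and>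
      (\<forall>x y. length x = n \<and> length y = n \<longrightarrow> f x y = \<sigma> (map2 h x y)))"


type_synonym coins = "nat \<Rightarrow> bool"

definition coin_space :: "coins measure" where
  "coin_space = PiM UNIV (\<lambda>_. measure_pmf (bernoulli_pmf (1/2)))"

definition public_coins :: "(coins \<times> coins) measure" where
  "public_coins = distr coin_space (coin_space \<Otimes>\<^sub>M coin_space) (\<lambda>r. (r, r))"

text \<open>A uniform bit \<open>r\<close> together with a copy \<open>s\<close> that is flipped with probability \<open>(1 - \<rho>)/2\<close>.\<close>

definition isr_pair :: "real \<Rightarrow> (bool \<times> bool) pmf" where
  "isr_pair \<rho> = do {
     r \<leftarrow> bernoulli_pmf (1/2);
     agree \<leftarrow> bernoulli_pmf ((1 + \<rho>)/2);
     return_pmf (r, if agree then r else \<not> r)}"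

definition isr_coins :: "real \<Rightarrow> (coins \<times> coins) measure" where
  "isr_coins \<rho> = distr (PiM UNIV (\<lambda>_. measure_pmf (isr_pair \<rho>))) (coin_space \<Otimes>\<^sub>M coin_space)
     (\<lambda>w. (\<lambda>i. fst (w i), \<lambda>i. snd (w i)))"


text \<open>Two-way protocols are trees whose leaves carry the output, so that the transcript determines
  the output. At an inner node the owner sends one bit computed from its own input and its own coins;
  the left subtree is taken on bit \<^term>\<open>True\<close>. All bits are required to be
  measurable functions of the coins.\<close>

datatype protocol =
    Output bool
  | Alice "bool list \<Rightarrow> coins \<Rightarrow> bool" protocol protocol
  | Bob "bool list \<Rightarrow> coins \<Rightarrow> bool" protocol protocol

primrec run :: "protocol \<Rightarrow> bool list \<Rightarrow> coins \<Rightarrow> bool list \<Rightarrow> coins \<Rightarrow> bool" where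
  "run (Output b) x r y s = b"
| "run (Alice a P Q) x r y s = (if a x r then run P x r y s else run Q x r y s)"
| "run (Bob b P Q) x r y s = (if b y s then run P x r y s else run Q x r y s)"

primrec cost :: "protocol \<Rightarrow> nat" where
  "cost (Output b) = 0"
| "cost (Alice a P Q) = Suc (max (cost P) (cost Q))"
| "cost (Bob b P Q) = Suc (max (cost P) (cost Q))"

primrec measurable_protocol :: "protocol \<Rightarrow> bool" where
  "measurable_protocol (Output b) \<longleftrightarrow> True"
| "measurable_protocol (Alice a P Q) \<longleftrightarrow>
    (\<forall>x. a x \<in> coin_space \<rightarrow>\<^sub>M count_space UNIV) \<and> measurable_protocol P \<and> measurable_protocol Q"
| "measurable_protocol (Bob b P Q) \<longleftrightarrow>
    (\<forall>y. b y \<in> coin_space \<rightarrow>\<^sub>M count_space UNIV) \<and> measurable_protocol P \<and> measurable_protocol Q"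

definition computes ::
    "(coins \<times> coins) measure \<Rightarrow> nat \<Rightarrow> (bool list \<Rightarrow> bool list \<Rightarrow> bool) \<Rightarrow> protocol \<Rightarrow> bool" where
  "computes M n f P \<longleftrightarrow> measurable_protocol P \<and>
    (\<forall>x y. length x = n \<and> length y = n \<longrightarrow>
      \<P>(w in M. run P x (fst w) y (snd w) = f x y) \<ge> 2/3)"

definition two_way_cc ::
    "(coins \<times> coins) measure \<Rightarrow> nat \<Rightarrow> (bool list \<Rightarrow> bool list \<Rightarrow> bool) \<Rightarrow> nat" where
  "two_way_cc M n f = (LEAST c. \<exists>P. computes M n f P \<and> cost P = c)"

text \<open>A one-way protocol of cost \<open>c\<close>: Alice sends \<open>c\<close> bits (\<open>enc\<close>), from which Bob, knowing also his
  own input and coins, produces the output (\<open>dec\<close>).\<close>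

definition one_way_computes ::
    "(coins \<times> coins) measure \<Rightarrow> nat \<Rightarrow> (bool list \<Rightarrow> bool list \<Rightarrow> bool) \<Rightarrow> nat \<Rightarrow>
     (bool list \<Rightarrow> coins \<Rightarrow> bool list) \<Rightarrow> (bool list \<Rightarrow> bool list \<Rightarrow> coins \<Rightarrow> bool) \<Rightarrow> bool" where
  "one_way_computes M n f c enc dec \<longleftrightarrow>
    (\<forall>x r. length (enc x r) = c) \<and>
    (\<forall>x. enc x \<in> coin_space \<rightarrow>\<^sub>M count_space UNIV) \<and>
    (\<forall>m y. dec m y \<in> coin_space \<rightarrow>\<^sub>M count_space UNIV) \<and>
    (\<forall>x y. length x = n \<and> length y = n \<longrightarrow>
      \<P>(w in M. dec (enc x (fst w)) y (snd w) = f x y) \<ge> 2/3)"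

definition one_way_cc ::
    "(coins \<times> coins) measure \<Rightarrow> nat \<Rightarrow> (bool list \<Rightarrow> bool list \<Rightarrow> bool) \<Rightarrow> nat" where
  "one_way_cc M n f = (LEAST c. \<exists>enc dec. one_way_computes M n f c enc dec)"

definition R_cc :: "nat \<Rightarrow> (bool list \<Rightarrow> bool list \<Rightarrow> bool) \<Rightarrow> nat" where
  "R_cc n f = two_way_cc public_coins n f"

definition ISR_cc :: "real \<Rightarrow> nat \<Rightarrow> (bool list \<Rightarrow> bool list \<Rightarrow> bool) \<Rightarrow> nat" where
  "ISR_cc \<rho> n f = two_way_cc (isr_coins \<rho>) n f"

definition ISR_one_way_cc :: "real \<Rightarrow> nat \<Rightarrow> (bool list \<Rightarrow> bool list \<Rightarrow> bool) \<Rightarrow> nat" where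
  "ISR_one_way_cc \<rho> n f = one_way_cc (isr_coins \<rho>) n f"


lemma map_fst_isr_pair: "map_pmf fst (isr_pair \<rho>) = bernoulli_pmf (1/2)"
  by (simp add: isr_pair_def map_bind_pmf bind_return_pmf')

lemma map_snd_isr_pair: "map_pmf snd (isr_pair \<rho>) = bernoulli_pmf (1/2)"
proof -
  have "Collect Not = {False}" "{b. b} = {True}" by auto
  then have *: "map_pmf Not (bernoulli_pmf (1/2)) = bernoulli_pmf (1/2)"
    by (intro pmf_eqI, case_tac i) (simp_all add: pmf_map vimage_def measure_pmf_single)
  have "map_pmf snd (isr_pair \<rho>) = do {
     agree \<leftarrow> bernoulli_pmf ((1 + \<rho>)/2); r \<leftarrow> bernoulli_pmf (1/2);
     return_pmf (if agree then r else \<not> r)}"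
    by (simp add: isr_pair_def map_bind_pmf) (rule bind_commute_pmf)
  also have "\<dots> = do {agree \<leftarrow> bernoulli_pmf ((1 + \<rho>)/2); bernoulli_pmf (1/2)}"
    using * by (intro bind_pmf_cong refl) (case_tac x, simp_all add: bind_return_pmf' map_pmf_def)
  finally show ?thesis by simp
qed

lemma prob_agree_isr_pair:
  assumes "0 \<le> \<rho>" "\<rho> \<le> 1"
  shows "measure_pmf.prob (isr_pair \<rho>) {(r, s). r = s} = (1 + \<rho>)/2"
proof -
  have "map_pmf (\<lambda>(r, s). r = s) (isr_pair \<rho>) = do {
     r \<leftarrow> bernoulli_pmf (1/2); agree \<leftarrow> bernoulli_pmf ((1 + \<rho>)/2); return_pmf agree}"
    unfolding isr_pair_def map_bind_pmf by (intro bind_pmf_cong refl) auto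
  also have "\<dots> = bernoulli_pmf ((1 + \<rho>)/2)"
    by (simp add: bind_return_pmf')
  finally have "pmf (map_pmf (\<lambda>(r, s). r = s) (isr_pair \<rho>)) True = (1 + \<rho>)/2"
    using assms by simp
  then show ?thesis
    by (simp add: pmf_map vimage_def case_prod_unfold)
qed

lemma measurable_public: "(\<lambda>r. (r, r)) \<in> coin_space \<rightarrow>\<^sub>M coin_space \<Otimes>\<^sub>M coin_space"
  by measurable

lemma measurable_isr:
  "(\<lambda>w. (\<lambda>i. fst (w i), \<lambda>i. snd (w i)))
     \<in> PiM UNIV (\<lambda>_. measure_pmf (isr_pair \<rho>)) \<rightarrow>\<^sub>M coin_space \<Otimes>\<^sub>M coin_space"
  unfolding coin_space_def
  by (intro measurable_Pair measurable_PiM_single')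
     (auto intro!: measurable_compose[OF measurable_component_singleton])

lemma prob_space_public_coins: "prob_space public_coins"
proof -
  have "prob_space coin_space"
    unfolding coin_space_def by (rule prob_space_PiM) (rule measure_pmf.prob_space_axioms)
  then show ?thesis
    unfolding public_coins_def by (rule prob_space.prob_space_distr) (rule measurable_public)
qed

lemma prob_space_isr_coins: "prob_space (isr_coins \<rho>)"
proof -
  have "prob_space (PiM (UNIV :: nat set) (\<lambda>_. measure_pmf (isr_pair \<rho>)))"
    by (rule prob_space_PiM) (rule measure_pmf.prob_space_axioms)
  then show ?thesis
    unfolding isr_coins_def by (rule prob_space.prob_space_distr) (rule measurable_isr)
qed

text \<open>Deterministic protocols show that the minima above range over nonempty sets.\<close>

primrec trivial_protocol :: "(bool list \<Rightarrow> bool list \<Rightarrow> bool) \<Rightarrow> nat \<Rightarrow> bool list \<Rightarrow> protocol" where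
  "trivial_protocol f 0 m = Bob (\<lambda>y s. f m y) (Output True) (Output False)"
| "trivial_protocol f (Suc k) m = Alice (\<lambda>x r. x ! length m)
     (trivial_protocol f k (m @ [True])) (trivial_protocol f k (m @ [False]))"

lemma run_trivial_protocol:
  "length x = length m + k \<Longrightarrow> m = take (length m) x \<Longrightarrow> run (trivial_protocol f k m) x r y s = f x y"
proof (induction k arbitrary: m)
  case (Suc k)
  have *: "m @ [x ! length m] = take (length (m @ [x ! length m])) x"
    using Suc.prems by (simp add: take_Suc_conv_app_nth)
  show ?case
    using Suc.IH[of "m @ [x ! length m]"] Suc.prems(1) * by (cases "x ! length m") auto
qed auto

lemma computes_exists:
  assumes "prob_space M"
  shows "\<exists>P. computes M n f P"
proof -
  have "measurable_protocol (trivial_protocol f k m)" for k m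
    by (induction k arbitrary: m) auto
  then show ?thesis
    using run_trivial_protocol[where m = "[]" and k = n] prob_space.prob_space[OF assms]
    by (intro exI[of _ "trivial_protocol f n []"]) (auto simp: computes_def)
qed

lemma one_way_computes_exists:
  assumes "prob_space M"
  shows "\<exists>c enc dec. one_way_computes M n f c enc dec"
  using prob_space.prob_space[OF assms]
  by (intro exI[of _ n] exI[of _ "\<lambda>x r. if length x = n then x else replicate n False"]
        exI[of _ "\<lambda>m y s. f m y"])
     (auto simp: one_way_computes_def)

end

theory Submission
  imports Defs
begin

text \<open>
  According to the gate \<open>h\<close>, the value \<open>f x y\<close> depends on one argument only, or it is \<open>G\<close> of the Hamming
  distance, or \<open>G\<close> of the number of positions with \<open>x\<^sub>i = \<alpha>\<close> and \<open>y\<^sub>i = \<beta>\<close>. A jump of \<open>G\<close> in the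
  interior of its domain embeds unique disjointness on many elements. Unique disjointness on \<open>m\<close>
  elements needs \<open>\<Omega>(m)\<close> bits: the Bar-Yossef--Jayram--Kumar--Sivakumar argument (Hellinger
  distance and cut and paste) applies, with the level-1 inequality in place of the chain rule for
  mutual information. So with \<open>k\<close> bits of public-coin communication all jumps lie within \<open>O(k)\<close> of the
  ends, and \<open>f\<close> is determined by cheap statistics of \<open>x\<close> and \<open>y\<close> and by Hamming distances truncated at
  some \<open>r = O(k)\<close>.

  For the latter let \<open>A = \<Sum>\<^sub>S \<surd>(w\<^sub>S) \<chi>\<^sub>S(x) r\<^sub>S\<close> and \<open>B = \<Sum>\<^sub>S \<surd>(w\<^sub>S) \<chi>\<^sub>S(y) s\<^sub>S\<close>, where \<open>S\<close> ranges over all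
  sets of coordinates and \<open>w\<close> is the \<open>p\<close>-biased measure. Then \<open>E[A B] = \<rho> (1 - 2 p)\<^sup>D\<close> for the distance
  \<open>D\<close>, and for \<open>p\<close> of order \<open>1/r\<close> consecutive values with \<open>D \<le> r\<close> differ by \<open>\<Omega>(1/r)\<close>. Hence \<open>O(r\<^sup>2)\<close>
  independent samples of \<open>A\<close>, each rounded to \<open>O(log r)\<close> bits, let Bob read off \<open>min D (r + 1)\<close>. This
  one-way protocol of cost \<open>O(k\<^sup>2 log k)\<close> yields both bounds.
\<close>

section \<open>The level-1 inequality\<close>

text \<open>\<open>ln (cosh x)\<close> is the cumulant generating function of a fair sign, so
  Hoeffding's lemma for a fair bit with parameter \<open>2 * x\<close> bounds it; evenness of
  \<open>cosh\<close> covers negative \<open>x\<close>.\<close>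

lemma cosh_le_exp_half_square: "cosh x \<le> exp (x\<^sup>2 / 2)" for x :: real
proof -
  have *: "cosh x \<le> exp (x\<^sup>2 / 2)" if "x \<ge> 0" for x :: real
  proof -
    have "- (2 * x) * (1/2) + ln (1 + (1/2) * (exp (2 * x) - 1)) \<le> (2 * x)\<^sup>2 / 8"
      by (rule Hoeffdings_lemma_aux) (use that in auto)
    moreover have "1 + (1/2) * (exp (2 * x) - 1) = exp x * cosh x"
      by (simp add: cosh_field_def field_simps flip: exp_add)
    ultimately have "ln (cosh x) \<le> x\<^sup>2 / 2"
      by (simp add: ln_mult field_simps)
    then show ?thesis
      by (metis cosh_real_pos exp_le_cancel_iff exp_ln)
  qed
  show ?thesis
    using *[of "\<bar>x\<bar>"] by simp
qed

lemma exp_plus_exp_minus_le: "exp x + exp (- x) \<le> 2 * exp (x\<^sup>2 / 2)" for x :: real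
  using cosh_le_exp_half_square[of x] by (simp add: cosh_field_def)

definition side :: "'a \<Rightarrow> 'a set \<Rightarrow> real" where
  "side i z = (if i \<in> z then 1 else -1)"

text \<open>Expanding the product chooses one exponential per coordinate, so its terms are indexed
  by subsets. This is the normalizing constant of a tilted product measure.\<close>

lemma sum_exp_sides:
  fixes u :: "'a \<Rightarrow> real"
  assumes "finite U"
  shows "(\<Sum>z\<in>Pow U. exp (\<Sum>i\<in>U. u i * side i z)) = (\<Prod>i\<in>U. exp (u i) + exp (- u i))"
proof -
  have "exp (\<Sum>i\<in>U. u i * side i z) = (\<Prod>i\<in>z. exp (u i)) * (\<Prod>i\<in>U - z. exp (- u i))"
    if z: "z \<in> Pow U" for z
  proof -
    have "(\<Sum>i\<in>U. u i * side i z) = (\<Sum>i\<in>z. u i * side i z) + (\<Sum>i\<in>U - z. u i * side i z)"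
      using z assms by (simp add: sum.subset_diff)
    also have "\<dots> = (\<Sum>i\<in>z. u i) + (\<Sum>i\<in>U - z. - u i)"
      by (simp add: side_def)
    finally show ?thesis
      using z assms by (simp add: exp_add exp_sum finite_subset flip: sum_negf)
  qed
  then show ?thesis
    using prod_add[OF assms, of "\<lambda>i. exp (u i)" "\<lambda>i. exp (- u i)"] by simp
qed

text \<open>The uniform distribution is tilted in the direction of the mean of \<open>S\<close>; with convexity of the
  exponential this replaces subadditivity of entropy.\<close>

lemma sum_squared_bias_le:
  fixes U :: "'a set"
  assumes "finite U" and S: "S \<subseteq> Pow U" "S \<noteq> {}"
  defines "\<mu> \<equiv> \<lambda>i. (\<Sum>z\<in>S. side i z) / card S"
  shows "(\<Sum>i\<in>U. (\<mu> i)\<^sup>2) \<le> 2 * ln (2 ^ card U / card S)"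
proof -
  have fin: "finite S"
    using assms(1) S finite_subset by blast
  have card: "card S > 0"
    using fin S by (simp add: card_gt_0_iff)
  define c where "c = (\<Sum>i\<in>U. (\<mu> i)\<^sup>2)"
  define v where "v z = (\<Sum>i\<in>U. \<mu> i * side i z)" for z
  have \<mu>: "\<mu> i * (\<Sum>z\<in>S. side i z) = card S * (\<mu> i)\<^sup>2" for i
    using card by (simp add: \<mu>_def power2_eq_square)
  have "(\<Sum>z\<in>S. v z) = (\<Sum>i\<in>U. \<mu> i * (\<Sum>z\<in>S. side i z))"
    unfolding v_def by (subst sum.swap) (simp add: sum_distrib_left)
  also have "\<dots> = card S * c"
    by (simp add: \<mu> c_def flip: sum_distrib_left)
  finally have v: "(\<Sum>z\<in>S. v z) = card S * c" .
  \<comment> \<open>The mean of \<open>v z\<close> over \<open>S\<close> is exactly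
    \<open>c\<close>, so the linear term of the tangent to \<open>exp\<close> at \<open>c\<close>
    sums to zero.\<close>
  have "card S * exp c = (\<Sum>z\<in>S. exp c * (1 + (v z - c)))"
    by (simp add: v sum_subtractf sum.distrib algebra_simps flip: sum_distrib_left)
  also have "\<dots> \<le> (\<Sum>z\<in>S. exp c * exp (v z - c))"
    by (intro sum_mono mult_left_mono exp_ge_add_one_self) auto
  also have "\<dots> = (\<Sum>z\<in>S. exp (v z))"
    by (simp flip: exp_add)
  also have "\<dots> \<le> (\<Sum>z\<in>Pow U. exp (v z))"
    using assms by (intro sum_mono2) auto
  also have "\<dots> = (\<Prod>i\<in>U. exp (\<mu> i) + exp (- \<mu> i))"
    unfolding v_def by (rule sum_exp_sides) fact
  also have "\<dots> \<le> (\<Prod>i\<in>U. 2 * exp ((\<mu> i)\<^sup>2 / 2))"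
    by (intro prod_mono conjI exp_plus_exp_minus_le) (auto intro: add_nonneg_nonneg)
  also have "\<dots> = 2 ^ card U * exp (c / 2)"
    using assms(1) by (simp add: prod.distrib c_def exp_sum sum_divide_distrib)
  finally have "exp (c / 2) * (card S * exp (c / 2)) \<le> exp (c / 2) * 2 ^ card U"
    by (simp add: mult_ac flip: exp_add)
  then have "exp (c / 2) \<le> 2 ^ card U / card S"
    using card by (simp add: field_simps)
  then have "c / 2 \<le> ln (2 ^ card U / card S)"
    using card by (subst ln_ge_iff) auto
  then show ?thesis
    by (simp add: c_def)
qed

text \<open>Entropy against the uniform distribution: use \<open>ln s \<le> s - 1\<close> at
  \<open>s = 1 / (p t * N)\<close>; the error terms \<open>1 / N - p t\<close> cancel in the
  sum.\<close>

lemma sum_mult_ln_inverse_le: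
  fixes p :: "'t \<Rightarrow> real"
  assumes "finite I" and p: "\<And>t. t \<in> I \<Longrightarrow> 0 \<le> p t" and "(\<Sum>t\<in>I. p t) = 1"
  shows "(\<Sum>t\<in>I. p t * ln (1 / p t)) \<le> ln (card I)"
proof -
  define N where "N = real (card I)"
  have N: "N > 0"
    using assms by (auto simp: N_def card_gt_0_iff)
  have "p t * ln (1 / p t) \<le> p t * ln N + (1 / N - p t)" if t: "t \<in> I" for t
  proof (cases "p t = 0")
    case False
    then have pt: "p t > 0" using p[OF t] by simp
    have "ln (1 / p t) = ln N + ln (1 / (p t * N))"
      using pt N by (simp add: ln_div ln_mult)
    moreover have "ln (1 / (p t * N)) \<le> 1 / (p t * N) - 1"
      using pt N by (intro ln_le_minus_one) simp
    ultimately have "p t * ln (1 / p t) \<le> p t * (ln N + (1 / (p t * N) - 1))"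
      using pt by simp
    also have "\<dots> = p t * ln N + (1 / N - p t)"
      using pt N by (simp add: field_simps)
    finally show ?thesis .
  qed (use N in simp)
  then have "(\<Sum>t\<in>I. p t * ln (1 / p t)) \<le> (\<Sum>t\<in>I. p t * ln N + (1 / N - p t))"
    by (rule sum_mono)
  also have "\<dots> = ln N"
    using assms(3) N by (simp add: sum.distrib sum_subtractf N_def flip: sum_distrib_right)
  finally show ?thesis
    by (simp add: N_def)
qed

section \<open>Cut and paste for partitions into rectangles\<close>

text \<open>Multiply by \<open>(sqrt a + sqrt b)\<^sup>2\<close>, which is at least
  \<open>a + b\<close>. This passes from squared Hellinger distance to a quantity that coordinate
  biases control.\<close>

lemma square_diff_sqrt_le:
  fixes a b :: real
  assumes "a \<ge> 0" "b \<ge> 0"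
  shows "(sqrt a - sqrt b)\<^sup>2 \<le> (a - b)\<^sup>2 / (a + b)"
proof (cases "a + b = 0")
  case False
  then have pos: "a + b > 0" using assms by linarith
  have "(sqrt a - sqrt b)\<^sup>2 * (a + b) \<le> (sqrt a - sqrt b)\<^sup>2 * (sqrt a + sqrt b)\<^sup>2"
    using assms by (intro mult_left_mono) (auto simp: power2_sum)
  also have "\<dots> = (a - b)\<^sup>2"
    using assms by (simp add: algebra_simps flip: power_mult_distrib)
  finally show ?thesis
    using pos by (simp add: field_simps)
next
  case True
  then have "a = 0" "b = 0" using assms by linarith+
  then show ?thesis by simp
qed

lemma square_diff_le_two_squares: "(x - z)\<^sup>2 \<le> 2 * (x - y)\<^sup>2 + 2 * (y - z)\<^sup>2" for x y z :: real
proof -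
  have "2 * (x - y)\<^sup>2 + 2 * (y - z)\<^sup>2 - (x - z)\<^sup>2 = (x - 2 * y + z)\<^sup>2"
    by (simp add: power2_eq_square algebra_simps)
  then show ?thesis
    by (metis diff_ge_0_iff_ge zero_le_power2)
qed

text \<open>Cut and paste: the Hellinger affinity of the laws \<open>a\<^sub>0 b\<^sub>0\<close> and \<open>a\<^sub>1 b\<^sub>1\<close> equals that of
  \<open>a\<^sub>0 b\<^sub>1\<close> and \<open>a\<^sub>1 b\<^sub>0\<close>, and both of the latter are compared to \<open>a\<^sub>0 b\<^sub>0\<close>.\<close>

lemma cut_and_paste:
  fixes a0 a1 b0 b1 :: "'t \<Rightarrow> real"
  assumes "finite I" "J \<subseteq> I"
    and nn: "\<And>t. a0 t \<ge> 0" "\<And>t. a1 t \<ge> 0" "\<And>t. b0 t \<ge> 0" "\<And>t. b1 t \<ge> 0"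
    and W: "(\<Sum>t\<in>I. a0 t * b0 t) = W" "(\<Sum>t\<in>I. a1 t * b1 t) = W"
      "(\<Sum>t\<in>I. a0 t * b1 t) = W" "(\<Sum>t\<in>I. a1 t * b0 t) = W"
  shows "(\<Sum>t\<in>J. a0 t * b0 t - a1 t * b1 t)\<^sup>2
    \<le> 8 * W * (\<Sum>t\<in>I. (a1 t - a0 t)\<^sup>2 / (a1 t + a0 t) * b0 t + a0 t * ((b1 t - b0 t)\<^sup>2 / (b1 t + b0 t)))"
    (is "_ \<le> 8 * W * ?R")
proof -
  define p q r s where defs: "p t = sqrt (a0 t)" "q t = sqrt (a1 t)" "r t = sqrt (b0 t)" "s t = sqrt (b1 t)" for t
  have sq: "a0 t = (p t)\<^sup>2" "a1 t = (q t)\<^sup>2" "b0 t = (r t)\<^sup>2" "b1 t = (s t)\<^sup>2" for t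
    using nn by (auto simp: defs)
  define u v where uv: "u t = p t * r t" "v t = q t * s t" for t
  have pos: "u t \<ge> 0" "v t \<ge> 0" for t
    using nn by (auto simp: uv defs)
  define H where "H = (\<Sum>t\<in>I. (u t - v t)\<^sup>2)"
  have "H = (\<Sum>t\<in>I. a0 t * b0 t + a1 t * b1 t - 2 * p t * q t * r t * s t)"
    unfolding H_def uv sq by (intro sum.cong refl) (simp add: power2_eq_square algebra_simps)
  \<comment> \<open>Cut and paste itself: the mixed term contains all four square roots and survives
    the exchange of \<open>b0\<close> and \<open>b1\<close>, while the other terms total
    \<open>2 * W\<close> for either pairing.\<close>
  also have "\<dots> = (\<Sum>t\<in>I. a0 t * b1 t + a1 t * b0 t - 2 * p t * q t * r t * s t)"
    using W by (simp add: sum.distrib sum_subtractf)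
  also have "\<dots> = (\<Sum>t\<in>I. (q t * r t - p t * s t)\<^sup>2)"
    unfolding sq by (intro sum.cong refl) (simp add: power2_eq_square algebra_simps)
  also have "\<dots> \<le> (\<Sum>t\<in>I. 2 * ((a1 t - a0 t)\<^sup>2 / (a1 t + a0 t) * b0 t + a0 t * ((b1 t - b0 t)\<^sup>2 / (b1 t + b0 t))))"
  proof (rule sum_mono)
    fix t
    \<comment> \<open>The intermediate point \<open>p t * r t\<close> belongs to the pair
      \<open>a0\<close>, \<open>b0\<close>, so that each remaining difference changes one player
      only.\<close>
    have "(q t * r t - p t * s t)\<^sup>2 \<le> 2 * (q t * r t - p t * r t)\<^sup>2 + 2 * (p t * r t - p t * s t)\<^sup>2"
      by (rule square_diff_le_two_squares)
    also have "\<dots> = 2 * ((q t - p t)\<^sup>2 * b0 t + a0 t * (s t - r t)\<^sup>2)"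
      by (simp add: sq power2_eq_square algebra_simps)
    also have "\<dots> \<le> 2 * ((a1 t - a0 t)\<^sup>2 / (a1 t + a0 t) * b0 t + a0 t * ((b1 t - b0 t)\<^sup>2 / (b1 t + b0 t)))"
      using nn unfolding defs
      by (intro mult_left_mono add_mono mult_right_mono square_diff_sqrt_le) auto
    finally show "(q t * r t - p t * s t)\<^sup>2 \<le> \<dots>" .
  qed
  also have "\<dots> = 2 * ?R"
    by (simp add: sum_distrib_left)
  finally have H: "H \<le> 2 * ?R" .
  have "(\<Sum>t\<in>J. a0 t * b0 t - a1 t * b1 t)\<^sup>2 \<le> (\<Sum>t\<in>I. \<bar>a0 t * b0 t - a1 t * b1 t\<bar>)\<^sup>2"
  proof (rule power2_le_iff_abs_le[THEN iffD2])
    have "\<bar>\<Sum>t\<in>J. a0 t * b0 t - a1 t * b1 t\<bar> \<le> (\<Sum>t\<in>J. \<bar>a0 t * b0 t - a1 t * b1 t\<bar>)"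
      by (rule sum_abs)
    also have "\<dots> \<le> (\<Sum>t\<in>I. \<bar>a0 t * b0 t - a1 t * b1 t\<bar>)"
      using assms by (intro sum_mono2) auto
    finally show "\<bar>\<Sum>t\<in>J. a0 t * b0 t - a1 t * b1 t\<bar> \<le> (\<Sum>t\<in>I. \<bar>a0 t * b0 t - a1 t * b1 t\<bar>)" .
  qed (auto intro: sum_nonneg)
  \<comment> \<open>Total variation is bounded through Hellinger distance: factor the difference of
    squares, then apply Cauchy-Schwarz.\<close>
  also have "(\<Sum>t\<in>I. \<bar>a0 t * b0 t - a1 t * b1 t\<bar>) = (\<Sum>t\<in>I. \<bar>u t - v t\<bar> * (u t + v t))"
  proof (rule sum.cong[OF refl])
    fix t
    have "a0 t * b0 t - a1 t * b1 t = (u t - v t) * (u t + v t)"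
      by (simp add: sq uv power2_eq_square algebra_simps)
    then show "\<bar>a0 t * b0 t - a1 t * b1 t\<bar> = \<bar>u t - v t\<bar> * (u t + v t)"
      using pos by (simp add: abs_mult)
  qed
  also have "\<dots>\<^sup>2 \<le> (\<Sum>t\<in>I. \<bar>u t - v t\<bar>\<^sup>2) * (\<Sum>t\<in>I. (u t + v t)\<^sup>2)"
    by (rule Cauchy_Schwarz_ineq_sum)
  also have "\<dots> \<le> H * (4 * W)"
  proof -
    have "(\<Sum>t\<in>I. (u t + v t)\<^sup>2) \<le> (\<Sum>t\<in>I. 2 * (a0 t * b0 t) + 2 * (a1 t * b1 t))"
    proof (rule sum_mono)
      fix t show "(u t + v t)\<^sup>2 \<le> 2 * (a0 t * b0 t) + 2 * (a1 t * b1 t)"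
        using square_diff_le_two_squares[of "u t" "- v t" 0] by (simp add: sq uv power_mult_distrib)
    qed
    also have "\<dots> = 4 * W"
      using W by (simp add: sum.distrib flip: sum_distrib_left)
    finally show ?thesis
      by (simp add: H_def mult_left_mono sum_nonneg)
  qed
  also have "\<dots> \<le> 2 * ?R * (4 * W)"
    using H W(1)[symmetric] nn by (intro mult_right_mono) (auto intro: sum_nonneg)
  finally show ?thesis
    by (simp add: mult_ac)
qed

section \<open>Bias and leakage in a rectangle partition\<close>

lemma card_split_conj:
  assumes "finite U" "e \<subseteq> U"
  shows "card {z \<in> Pow U. P (z \<inter> e) \<and> Q (z - e)} = card {x \<in> Pow e. P x} * card {y \<in> Pow (U - e). Q y}"
proof -
  have "bij_betw (\<lambda>z. (z \<inter> e, z - e)) {z \<in> Pow U. P (z \<inter> e) \<and> Q (z - e)}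
      ({x \<in> Pow e. P x} \<times> {y \<in> Pow (U - e). Q y})"
    by (rule bij_betwI[where g = "\<lambda>(x, y). x \<union> y"])
       (use assms in \<open>auto simp: Int_Un_distrib2 Un_Diff Int_absorb2 Diff_triv\<close>,
        (metis (no_types, lifting) Diff_eq_empty_iff Diff_triv Int_absorb2 Int_commute Un_empty_left Un_empty_right
          disjoint_iff DiffE subset_eq)+)
  then show ?thesis
    by (simp add: bij_betw_same_card card_cartesian_product)
qed

text \<open>The combinatorial content of a protocol with fixed coins: \<open>I\<close> is the set of
  leaves, and the inputs reaching leaf \<open>t\<close> form the rectangle given by
  \<open>A t\<close> and \<open>B t\<close>.\<close>

locale rectangle_partition =
  fixes U :: "'a set" and I :: "'t set" and A B :: "'t \<Rightarrow> 'a set \<Rightarrow> bool"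
  assumes finite_U: "finite U" and finite_I: "finite I"
    and partition: "\<And>x y. x \<subseteq> U \<Longrightarrow> y \<subseteq> U \<Longrightarrow> \<exists>!t. t \<in> I \<and> A t x \<and> B t y"
begin

text \<open>A set \<open>d\<close> names the coordinates on which Alice's input is free; Bob's is free on the complement.
  The pairs \<open>(z \<inter> d, z - d)\<close> with \<open>z\<close> uniform are disjoint and, for fixed \<open>d\<close>, independent.\<close>

definition fiber :: "'a set \<Rightarrow> 't \<Rightarrow> 'a set set" where
  "fiber d t = {z \<in> Pow U. A t (z \<inter> d) \<and> B t (z - d)}"

definition bias :: "'a \<Rightarrow> 'a set \<Rightarrow> 't \<Rightarrow> real" where
  "bias i d t = (\<Sum>z\<in>fiber d t. side i z) / card (fiber d t)"

text \<open>Up to the factor \<open>2 ^ card U\<close>, the mean squared bias of coordinate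
  \<open>i\<close> given the leaf. It stands in for the mutual information between this coordinate
  and the transcript.\<close>

definition leakage :: "'a \<Rightarrow> 'a set \<Rightarrow> real" where
  "leakage i d = (\<Sum>t\<in>I. card (fiber d t) * (bias i d t)\<^sup>2)"

lemma sum_card_cells:
  assumes "finite Z" and "J \<subseteq> I"
    and sub: "\<And>z. z \<in> Z \<Longrightarrow> g z \<subseteq> U \<and> h z \<subseteq> U"
  shows "(\<Sum>t\<in>J. card {z \<in> Z. A t (g z) \<and> B t (h z)})
    = card {z \<in> Z. \<exists>t\<in>J. A t (g z) \<and> B t (h z)}"
proof -
  have fin: "finite J"
    using assms finite_I finite_subset by blast
  have "card {z \<in> Z. \<exists>t\<in>J. A t (g z) \<and> B t (h z)} = card (\<Union>t\<in>J. {z \<in> Z. A t (g z) \<and> B t (h z)})"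
    by (rule arg_cong[where f = card]) auto
  also have "\<dots> = (\<Sum>t\<in>J. card {z \<in> Z. A t (g z) \<and> B t (h z)})"
  proof (rule card_UN_disjoint)
    show "\<forall>s\<in>J. \<forall>t\<in>J. s \<noteq> t \<longrightarrow>
        {z \<in> Z. A s (g z) \<and> B s (h z)} \<inter> {z \<in> Z. A t (g z) \<and> B t (h z)} = {}"
    proof (intro ballI impI)
      fix s t assume st: "s \<in> J" "t \<in> J" "s \<noteq> t"
      have False if "z \<in> Z" "A s (g z)" "B s (h z)" "A t (g z)" "B t (h z)" for z
        using partition[of "g z" "h z"] sub[OF that(1)] that st \<open>J \<subseteq> I\<close> by blast
      then show "{z \<in> Z. A s (g z) \<and> B s (h z)} \<inter> {z \<in> Z. A t (g z) \<and> B t (h z)} = {}"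
        by blast
    qed
  qed (use fin assms in auto)
  finally show ?thesis ..
qed

lemma sum_card_cells_total:
  assumes "finite Z" and sub: "\<And>z. z \<in> Z \<Longrightarrow> g z \<subseteq> U \<and> h z \<subseteq> U"
  shows "(\<Sum>t\<in>I. card {z \<in> Z. A t (g z) \<and> B t (h z)}) = card Z"
proof -
  have "\<exists>t\<in>I. A t (g z) \<and> B t (h z)" if "z \<in> Z" for z
    using partition[of "g z" "h z"] sub[OF that] by blast
  then have "{z \<in> Z. \<exists>t\<in>I. A t (g z) \<and> B t (h z)} = Z"
    by auto
  then show ?thesis
    using sum_card_cells[OF assms(1) subset_refl, of g h] sub by simp
qed

text \<open>Each fiber obeys the level-1 inequality. Weighting the fibers by their densities
  \<open>p t\<close> turns the right-hand sides into the entropy of the leaf.\<close>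

lemma sum_leakage_le:
  assumes "d \<subseteq> U"
  shows "(\<Sum>i\<in>U. leakage i d) \<le> 2 ^ card U * (2 * ln (card I))"
proof -
  define p where "p t = real (card (fiber d t)) / 2 ^ card U" for t
  have "(\<Sum>i\<in>U. leakage i d) = (\<Sum>t\<in>I. card (fiber d t) * (\<Sum>i\<in>U. (bias i d t)\<^sup>2))"
    unfolding leakage_def by (subst sum.swap) (simp add: sum_distrib_left)
  also have "\<dots> \<le> (\<Sum>t\<in>I. 2 ^ card U * 2 * (p t * ln (1 / p t)))"
  proof (rule sum_mono)
    fix t
    show "card (fiber d t) * (\<Sum>i\<in>U. (bias i d t)\<^sup>2) \<le> 2 ^ card U * 2 * (p t * ln (1 / p t))"
    proof (cases "fiber d t = {}")
      case False
      have "(\<Sum>i\<in>U. (bias i d t)\<^sup>2) \<le> 2 * ln (2 ^ card U / card (fiber d t))"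
        unfolding bias_def using False
        by (intro sum_squared_bias_le finite_U) (auto simp: fiber_def)
      then have "card (fiber d t) * (\<Sum>i\<in>U. (bias i d t)\<^sup>2)
          \<le> card (fiber d t) * (2 * ln (2 ^ card U / card (fiber d t)))"
        by (intro mult_left_mono) auto
      then show ?thesis
        by (simp add: p_def)
    qed (simp add: p_def)
  qed
  also have "\<dots> = 2 ^ card U * 2 * (\<Sum>t\<in>I. p t * ln (1 / p t))"
    by (simp add: sum_distrib_left)
  also have "\<dots> \<le> 2 ^ card U * 2 * ln (card I)"
  proof (intro mult_left_mono sum_mult_ln_inverse_le finite_I)
    have "(\<Sum>t\<in>I. card (fiber d t)) = card (Pow U)"
      unfolding fiber_def using finite_U by (intro sum_card_cells_total) auto
    then show "(\<Sum>t\<in>I. p t) = 1"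
      by (simp add: p_def card_Pow finite_U flip: sum_divide_distrib of_nat_sum)
  qed (auto simp: p_def)
  finally show ?thesis
    by simp
qed

definition put :: "bool \<Rightarrow> 'a \<Rightarrow> 'a set \<Rightarrow> 'a set" where
  "put b i x = (if b then insert i x else x)"

text \<open>\<open>e\<close> is the set of Alice's free coordinates other than \<open>i\<close>, so
  coordinate \<open>i\<close> can be set separately for each player. Row and column counts are the
  unnormalized probabilities that the two players are consistent with leaf \<open>t\<close>.\<close>

definition row_count :: "'a \<Rightarrow> 'a set \<Rightarrow> bool \<Rightarrow> 't \<Rightarrow> nat" where
  "row_count i e b t = card {x \<in> Pow e. A t (put b i x)}"

definition col_count :: "'a \<Rightarrow> 'a set \<Rightarrow> bool \<Rightarrow> 't \<Rightarrow> nat" where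
  "col_count i e b t = card {y \<in> Pow (U - {i} - e). B t (put b i y)}"

lemma row_count_mult_col_count:
  assumes "e \<subseteq> U - {i}"
  shows "row_count i e a t * col_count i e b t
    = card {z \<in> Pow (U - {i}). A t (put a i (z \<inter> e)) \<and> B t (put b i (z - e))}"
  unfolding row_count_def col_count_def
  by (rule card_split_conj[symmetric]) (use finite_U assms in auto)

lemma sum_row_count_mult_col_count:
  assumes "i \<in> U" "e \<subseteq> U - {i}"
  shows "(\<Sum>t\<in>I. real (row_count i e a t) * real (col_count i e b t)) = 2 ^ (card U - 1)"
proof -
  have "(\<Sum>t\<in>I. row_count i e a t * col_count i e b t) = card (Pow (U - {i}))"
    unfolding row_count_mult_col_count[OF assms(2)]
    using assms finite_U by (intro sum_card_cells_total) (auto simp: put_def)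
  then show ?thesis
    using assms finite_U by (simp add: card_Pow flip: of_nat_mult of_nat_sum)
qed

text \<open>Membership of \<open>i\<close> in \<open>d\<close> decides which player receives
  coordinate \<open>i\<close>; the other player has 0 there. Hence 1 on both sides never occurs in a
  fiber.\<close>

lemma fiber_parts:
  assumes i: "i \<in> U" and e: "e \<subseteq> U - {i}"
  shows "card {z \<in> fiber (insert i e) t. i \<in> z} = row_count i e True t * col_count i e False t"
    and "card {z \<in> fiber (insert i e) t. i \<notin> z} = row_count i e False t * col_count i e False t"
    and "card {z \<in> fiber e t. i \<in> z} = row_count i e False t * col_count i e True t"
    and "card {z \<in> fiber e t. i \<notin> z} = row_count i e False t * col_count i e False t"
proof -
  have inter: "insert i z \<inter> insert i e = insert i (z \<inter> e)" "insert i z \<inter> e = z \<inter> e"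
    "insert i z - insert i e = z - e" "insert i z - e = insert i (z - e)"
    "z \<inter> insert i e = z \<inter> e" "z - insert i e = z - e" if "z \<subseteq> U - {i}" for z
    using that e by auto
  have upper: "card {z \<in> Pow U. i \<in> z \<and> P z} = card {z \<in> Pow (U - {i}). P (insert i z)}" for P
  proof -
    have "{z \<in> Pow U. i \<in> z \<and> P z} = insert i ` {z \<in> Pow (U - {i}). P (insert i z)}"
      using i by (auto simp: image_iff insert_absorb intro!: exI[of _ "_ - {i}"])
    moreover have "inj_on (insert i) {z \<in> Pow (U - {i}). P (insert i z)}"
      by (auto simp: inj_on_def)
    ultimately show ?thesis
      by (simp add: card_image)
  qed
  have lower: "{z \<in> Pow U. i \<notin> z \<and> P z} = {z \<in> Pow (U - {i}). P z}" for P
    by auto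
  have eq: "{z \<in> fiber d t. i \<in> z} = {z \<in> Pow U. i \<in> z \<and> A t (z \<inter> d) \<and> B t (z - d)}"
    "{z \<in> fiber d t. i \<notin> z} = {z \<in> Pow U. i \<notin> z \<and> A t (z \<inter> d) \<and> B t (z - d)}" for d
    by (auto simp: fiber_def)
  show "card {z \<in> fiber (insert i e) t. i \<in> z} = row_count i e True t * col_count i e False t"
    unfolding row_count_mult_col_count[OF e] eq upper
    by (intro arg_cong[where f = card] Collect_cong) (auto simp: put_def inter)
  show "card {z \<in> fiber (insert i e) t. i \<notin> z} = row_count i e False t * col_count i e False t"
    unfolding row_count_mult_col_count[OF e] eq lower
    by (intro arg_cong[where f = card] Collect_cong) (auto simp: put_def inter)
  show "card {z \<in> fiber e t. i \<in> z} = row_count i e False t * col_count i e True t"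
    unfolding row_count_mult_col_count[OF e] eq upper
    by (intro arg_cong[where f = card] Collect_cong) (auto simp: put_def inter)
  show "card {z \<in> fiber e t. i \<notin> z} = row_count i e False t * col_count i e False t"
    unfolding row_count_mult_col_count[OF e] eq lower by (simp add: put_def)
qed

text \<open>If the halves of the fiber have sizes \<open>c1\<close> and \<open>c0\<close>, the bias
  is \<open>(c1 - c0) / (c1 + c0)\<close>. This is the shape of the error terms in
  \<open>cut_and_paste\<close>.\<close>

lemma card_fiber_mult_square_bias:
  "card (fiber d t) * (bias i d t)\<^sup>2 =
    (real (card {z \<in> fiber d t. i \<in> z}) - real (card {z \<in> fiber d t. i \<notin> z}))\<^sup>2 /
    (real (card {z \<in> fiber d t. i \<in> z}) + real (card {z \<in> fiber d t. i \<notin> z}))"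
proof -
  have fin: "finite (fiber d t)"
    using finite_U by (simp add: fiber_def)
  have split: "fiber d t = {z \<in> fiber d t. i \<in> z} \<union> {z \<in> fiber d t. i \<notin> z}"
    by auto
  have "card (fiber d t) = card {z \<in> fiber d t. i \<in> z} + card {z \<in> fiber d t. i \<notin> z}"
    by (subst split, subst card_Un_disjoint) (use fin in auto)
  moreover have "(\<Sum>z\<in>fiber d t. side i z) = real (card {z \<in> fiber d t. i \<in> z}) - real (card {z \<in> fiber d t. i \<notin> z})"
    by (subst split, subst sum.union_disjoint) (use fin in \<open>auto simp: side_def\<close>)
  ultimately show ?thesis
    by (auto simp: bias_def power_divide power2_eq_square)
qed

text \<open>For \<open>J\<close> the leaves whose output is the value on disjoint pairs, this is the
  unnormalized drop in acceptance when \<open>i\<close> is put into both inputs. The second term is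
  the combination that no fiber contains.\<close>

definition advantage :: "'t set \<Rightarrow> 'a \<Rightarrow> 'a set \<Rightarrow> real" where
  "advantage J i e = (\<Sum>t\<in>J. real (row_count i e False t) * real (col_count i e False t)
    - real (row_count i e True t) * real (col_count i e True t))"

text \<open>\<open>cut_and_paste\<close> is applied to the two values of coordinate \<open>i\<close>
  for each player. By \<open>fiber_parts\<close> its error sums are the leakages with
  \<open>i\<close> given to Alice and to Bob, respectively.\<close>

lemma square_advantage_le:
  assumes i: "i \<in> U" and e: "e \<subseteq> U - {i}" and J: "J \<subseteq> I"
  shows "(advantage J i e)\<^sup>2 \<le> 8 * 2 ^ (card U - 1) * (leakage i (insert i e) + leakage i e)"
proof -
  have "leakage i (insert i e) + leakage i e =
     (\<Sum>t\<in>I. (real (row_count i e True t) - real (row_count i e False t))\<^sup>2 /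
            (real (row_count i e True t) + real (row_count i e False t)) * real (col_count i e False t) +
          real (row_count i e False t) * ((real (col_count i e True t) - real (col_count i e False t))\<^sup>2 /
            (real (col_count i e True t) + real (col_count i e False t))))"
    unfolding leakage_def sum.distrib[symmetric] card_fiber_mult_square_bias fiber_parts[OF i e]
  proof (intro sum.cong refl arg_cong2[where f = "(+)"], goal_cases)
    \<comment> \<open>The count of the unchanged player is a common factor, squared in the numerator
      and simple in the denominator; where it is 0, both sides vanish.\<close>
    case (1 t)
    then show ?case
      by (cases "col_count i e False t = 0")
         (simp_all add: power2_eq_square flip: left_diff_distrib distrib_right)
  next
    case (2 t)
    then show ?case
      by (cases "row_count i e False t = 0")
         (simp_all add: power2_eq_square flip: right_diff_distrib distrib_left)
  qed
  then show ?thesis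
    unfolding advantage_def
    using cut_and_paste[OF finite_I J, of "\<lambda>t. real (row_count i e False t)" "\<lambda>t. real (row_count i e True t)"
        "\<lambda>t. real (col_count i e False t)" "\<lambda>t. real (col_count i e True t)" "2 ^ (card U - 1)"]
    by (simp add: sum_row_count_mult_col_count[OF i e])
qed

text \<open>For fixed \<open>i\<close>, the sets \<open>e\<close> and \<open>insert i e\<close>
  together run once through all subsets of \<open>U\<close>; after exchanging the sums,
  \<open>sum_leakage_le\<close> applies to each subset.\<close>

lemma sum_square_advantage_le:
  assumes J: "J \<subseteq> I"
  shows "(\<Sum>i\<in>U. \<Sum>e\<in>Pow (U - {i}). (advantage J i e)\<^sup>2)
    \<le> 8 * 2 ^ (card U - 1) * (2 ^ card U * (2 ^ card U * (2 * ln (card I))))"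
proof -
  have "(\<Sum>i\<in>U. \<Sum>e\<in>Pow (U - {i}). (advantage J i e)\<^sup>2)
      \<le> (\<Sum>i\<in>U. \<Sum>e\<in>Pow (U - {i}). 8 * 2 ^ (card U - 1) * (leakage i (insert i e) + leakage i e))"
    using J by (intro sum_mono square_advantage_le) auto
  also have "\<dots> = 8 * 2 ^ (card U - 1) * (\<Sum>i\<in>U. \<Sum>e\<in>Pow (U - {i}). leakage i (insert i e) + leakage i e)"
    by (simp add: sum_distrib_left)
  also have "(\<Sum>i\<in>U. \<Sum>e\<in>Pow (U - {i}). leakage i (insert i e) + leakage i e)
      = (\<Sum>i\<in>U. \<Sum>d\<in>Pow U. leakage i d)"
  proof (rule sum.cong[OF refl])
    fix i assume i: "i \<in> U"
    have "Pow U = Pow (U - {i}) \<union> insert i ` Pow (U - {i})"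
      using i Pow_insert[of i "U - {i}"] by (simp add: insert_absorb)
    moreover have "Pow (U - {i}) \<inter> insert i ` Pow (U - {i}) = {}"
      by auto
    moreover have "inj_on (insert i) (Pow (U - {i}))"
      by (auto simp: inj_on_def)
    ultimately show "(\<Sum>e\<in>Pow (U - {i}). leakage i (insert i e) + leakage i e) = (\<Sum>d\<in>Pow U. leakage i d)"
      using finite_U by (simp add: sum.union_disjoint sum.reindex sum.distrib)
  qed
  also have "\<dots> = (\<Sum>d\<in>Pow U. \<Sum>i\<in>U. leakage i d)"
    by (rule sum.swap)
  also have "8 * 2 ^ (card U - 1) * \<dots> \<le> 8 * 2 ^ (card U - 1) * (\<Sum>d\<in>Pow U. 2 ^ card U * (2 * ln (card I)))"
    by (intro mult_left_mono sum_mono sum_leakage_le) auto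
  also have "\<dots> = 8 * 2 ^ (card U - 1) * (2 ^ card U * (2 ^ card U * (2 * ln (card I))))"
    using finite_U by (simp add: card_Pow)
  finally show ?thesis .
qed

lemma advantage_eq:
  assumes i: "i \<in> U" and e: "e \<subseteq> U - {i}" and J: "J \<subseteq> I"
  shows "advantage J i e = (\<Sum>z\<in>Pow (U - {i}).
      of_bool (\<exists>t\<in>J. A t (z \<inter> e) \<and> B t (z - e)) -
      of_bool (\<exists>t\<in>J. A t (insert i (z \<inter> e)) \<and> B t (insert i (z - e))))"
proof -
  have "(\<Sum>t\<in>J. row_count i e b t * col_count i e b t)
      = card {z \<in> Pow (U - {i}). \<exists>t\<in>J. A t (put b i (z \<inter> e)) \<and> B t (put b i (z - e))}" for b
    unfolding row_count_mult_col_count[OF e]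
    using i e J finite_U by (intro sum_card_cells) (auto simp: put_def)
  from arg_cong[OF this, of real] show ?thesis
    using finite_U unfolding advantage_def sum_subtractf
    by (simp add: put_def sum_of_bool_eq Int_def)
qed

theorem card_le_ln_card_cells:
  assumes J: "J \<subseteq> I"
    and adv: "(\<Sum>i\<in>U. \<Sum>e\<in>Pow (U - {i}). advantage J i e) \<ge> card U * (2 ^ (card U - 1))\<^sup>2 / 3"
  shows "card U \<le> 576 * ln (card I)"
proof (cases "U = {}")
  case True
  have "card I > 0"
    using partition[of "{}" "{}"] finite_I by (auto simp: card_gt_0_iff)
  then show ?thesis
    using True by simp
next
  case False
  define W :: real where "W = 2 ^ (card U - 1)"
  define m where "m = real (card U)"
  have W: "W > 0" "2 ^ card U = 2 * W"
    using False finite_U by (auto simp: W_def card_gt_0_iff simp flip: power_Suc)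
  \<comment> \<open>Jensen's inequality in linear form: the square is replaced by its tangent at
    \<open>W / 3\<close>, the guaranteed average advantage over the \<open>m * W\<close> pairs of
    \<open>i\<close> and \<open>e\<close>. Comparison with the upper bound gives 576 = 9 *
    64.\<close>
  have "m * W ^ 3 / 9 = 2 / 3 * W * (m * W\<^sup>2 / 3) - (\<Sum>i\<in>U. \<Sum>e\<in>Pow (U - {i}). W\<^sup>2 / 9)"
    using finite_U by (simp add: card_Pow m_def W_def field_simps power2_eq_square power3_eq_cube)
  also have "\<dots> \<le> 2 / 3 * W * (\<Sum>i\<in>U. \<Sum>e\<in>Pow (U - {i}). advantage J i e) - (\<Sum>i\<in>U. \<Sum>e\<in>Pow (U - {i}). W\<^sup>2 / 9)"
    using adv W by (intro diff_mono mult_left_mono) (auto simp: m_def W_def)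
  also have "\<dots> = (\<Sum>i\<in>U. \<Sum>e\<in>Pow (U - {i}). 2 / 3 * W * advantage J i e - W\<^sup>2 / 9)"
    by (simp only: sum_subtractf sum_distrib_left)
  also have "\<dots> \<le> (\<Sum>i\<in>U. \<Sum>e\<in>Pow (U - {i}). (advantage J i e)\<^sup>2)"
  proof (intro sum_mono)
    fix i e
    have "(advantage J i e - W / 3)\<^sup>2 \<ge> 0" by simp
    then show "2 / 3 * W * advantage J i e - W\<^sup>2 / 9 \<le> (advantage J i e)\<^sup>2"
      by (simp add: power2_eq_square field_simps)
  qed
  also have "\<dots> \<le> 64 * ln (card I) * W ^ 3"
    using sum_square_advantage_le[OF J] W(2) by (simp add: W_def power3_eq_cube mult_ac)
  finally have "m / 9 * W ^ 3 \<le> 64 * ln (card I) * W ^ 3"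
    by simp
  then show ?thesis
    using W by (simp add: m_def)
qed

end

section \<open>Unique disjointness\<close>

definition is_transcript_partition ::
    "protocol \<Rightarrow> coins \<Rightarrow> coins \<Rightarrow> 't set \<Rightarrow> ('t \<Rightarrow> bool list \<Rightarrow> bool) \<Rightarrow> ('t \<Rightarrow> bool list \<Rightarrow> bool) \<Rightarrow>
     (bool list \<Rightarrow> bool list \<Rightarrow> 't) \<Rightarrow> ('t \<Rightarrow> bool) \<Rightarrow> bool" where
  "is_transcript_partition P r s I A B leaf out \<longleftrightarrow> finite I \<and> card I \<le> 2 ^ cost P \<and>
    (\<forall>x y. leaf x y \<in> I \<and> A (leaf x y) x \<and> B (leaf x y) y \<and> run P x r y s = out (leaf x y)) \<and>
    (\<forall>x y t. t \<in> I \<longrightarrow> A t x \<longrightarrow> B t y \<longrightarrow> t = leaf x y)"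

text \<open>Leaves are named by their paths. With fixed coins, the conditions imposed along a path
  by one player's bits concern that player's input only, so they define a rectangle.\<close>

lemma transcript_partition_exists:
  "\<exists>(I :: bool list set) A B leaf out. is_transcript_partition P r s I A B leaf out"
proof (induction P)
  case (Output b)
  show ?case
    unfolding is_transcript_partition_def
    by (intro exI[of _ "{[]}"] exI[of _ "\<lambda>_ _. True"] exI[of _ "\<lambda>_ _. []"] exI[of _ "\<lambda>_. b"]) auto
next
  case (Alice a P Q)
  obtain I :: "bool list set" and A B leaf out where P: "is_transcript_partition P r s I A B leaf out"
    using Alice.IH(1) by blast
  obtain I' :: "bool list set" and A' B' leaf' out' where Q: "is_transcript_partition Q r s I' A' B' leaf' out'"
    using Alice.IH(2) by blast
  note P = P[unfolded is_transcript_partition_def] and Q = Q[unfolded is_transcript_partition_def]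
  have cards: "card I \<le> 2 ^ max (cost P) (cost Q)" "card I' \<le> 2 ^ max (cost P) (cost Q)"
    using P Q by (auto intro: order_trans[OF _ power_increasing])
  have "card ((#) True ` I \<union> (#) False ` I') \<le> card I + card I'"
    using P Q by (intro order_trans[OF card_Un_le] add_mono card_image_le) auto
  also have "\<dots> \<le> 2 ^ max (cost P) (cost Q) + 2 ^ max (cost P) (cost Q)"
    using cards by (rule add_mono)
  finally have card: "card ((#) True ` I \<union> (#) False ` I') \<le> 2 ^ cost (Alice a P Q)"
    by simp
  show ?case
    unfolding is_transcript_partition_def
    \<comment> \<open>The head of a path is the bit sent at the root; since Alice owns the root,
      only her predicate tests this bit.\<close>
    by (rule exI[of _ "(#) True ` I \<union> (#) False ` I'"],
          rule exI[of _ "\<lambda>t x. if hd t then a x r \<and> A (tl t) x else \<not> a x r \<and> A' (tl t) x"],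
          rule exI[of _ "\<lambda>t y. if hd t then B (tl t) y else B' (tl t) y"],
          rule exI[of _ "\<lambda>x y. if a x r then True # leaf x y else False # leaf' x y"],
          rule exI[of _ "\<lambda>t. if hd t then out (tl t) else out' (tl t)"])
       (use card P Q in auto)
next
  case (Bob b P Q)
  obtain I :: "bool list set" and A B leaf out where P: "is_transcript_partition P r s I A B leaf out"
    using Bob.IH(1) by blast
  obtain I' :: "bool list set" and A' B' leaf' out' where Q: "is_transcript_partition Q r s I' A' B' leaf' out'"
    using Bob.IH(2) by blast
  note P = P[unfolded is_transcript_partition_def] and Q = Q[unfolded is_transcript_partition_def]
  have cards: "card I \<le> 2 ^ max (cost P) (cost Q)" "card I' \<le> 2 ^ max (cost P) (cost Q)"
    using P Q by (auto intro: order_trans[OF _ power_increasing])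
  have "card ((#) True ` I \<union> (#) False ` I') \<le> card I + card I'"
    using P Q by (intro order_trans[OF card_Un_le] add_mono card_image_le) auto
  also have "\<dots> \<le> 2 ^ max (cost P) (cost Q) + 2 ^ max (cost P) (cost Q)"
    using cards by (rule add_mono)
  finally have card: "card ((#) True ` I \<union> (#) False ` I') \<le> 2 ^ cost (Bob b P Q)"
    by simp
  show ?case
    unfolding is_transcript_partition_def
    by (rule exI[of _ "(#) True ` I \<union> (#) False ` I'"],
          rule exI[of _ "\<lambda>t x. if hd t then A (tl t) x else A' (tl t) x"],
          rule exI[of _ "\<lambda>t y. if hd t then b y s \<and> B (tl t) y else \<not> b y s \<and> B' (tl t) y"],
          rule exI[of _ "\<lambda>x y. if b y s then True # leaf x y else False # leaf' x y"],
          rule exI[of _ "\<lambda>t. if hd t then out (tl t) else out' (tl t)"])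
       (use card P Q in auto)
qed

lemma measurable_run:
  "measurable_protocol P \<Longrightarrow>
    (\<lambda>w. run P x (fst w) y (snd w)) \<in> coin_space \<Otimes>\<^sub>M coin_space \<rightarrow>\<^sub>M count_space UNIV"
proof (induction P)
  case (Alice a P Q)
  have [measurable]: "(\<lambda>w. a x (fst w)) \<in> coin_space \<Otimes>\<^sub>M coin_space \<rightarrow>\<^sub>M count_space UNIV"
    using Alice.prems by (intro measurable_compose[OF measurable_fst]) auto
  show ?case
    using Alice by simp
next
  case (Bob b P Q)
  have [measurable]: "(\<lambda>w. b y (snd w)) \<in> coin_space \<Otimes>\<^sub>M coin_space \<rightarrow>\<^sub>M count_space UNIV"
    using Bob.prems by (intro measurable_compose[OF measurable_snd]) auto
  show ?case
    using Bob by simp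
qed simp

lemma prob_space_coin_space: "prob_space coin_space"
  unfolding coin_space_def by (rule prob_space_PiM) (rule measure_pmf.prob_space_axioms)

lemma measurable_run_diagonal:
  assumes "measurable_protocol P"
  shows "(\<lambda>r. run P x r y r) \<in> coin_space \<rightarrow>\<^sub>M count_space UNIV"
  using measurable_compose[OF measurable_public measurable_run[OF assms]] by simp

lemma prob_run_public_coins:
  assumes "measurable_protocol P"
  shows "\<P>(w in public_coins. run P x (fst w) y (snd w) = b) = \<P>(r in coin_space. run P x r y r = b)"
proof -
  have "{w \<in> space (coin_space \<Otimes>\<^sub>M coin_space). run P x (fst w) y (snd w) = b}
      \<in> sets (coin_space \<Otimes>\<^sub>M coin_space)"
    using measurable_run[OF assms, of x y] by measurable
  then show ?thesis
    unfolding public_coins_def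
    by (subst measure_distr[OF measurable_public]) (auto intro!: arg_cong2[where f = measure] simp: space_pair_measure)
qed

text \<open>Averaging fixes coins whose total advantage is at least the mean. The protocol is then a
  partition into at most \<open>2 ^ cost P\<close> rectangles, and
  \<open>card_le_ln_card_cells\<close> applies. The maps \<open>\<phi>\<close> and
  \<open>\<psi>\<close> let reductions encode the two sets differently.\<close>

theorem unique_disjointness_bound:
  fixes \<phi> \<psi> :: "'a set \<Rightarrow> bool list"
  assumes P: "computes public_coins n f P" and "finite U"
    and len: "\<And>x. x \<subseteq> U \<Longrightarrow> length (\<phi> x) = n" "\<And>y. y \<subseteq> U \<Longrightarrow> length (\<psi> y) = n"
    and disj: "\<And>x y. x \<subseteq> U \<Longrightarrow> y \<subseteq> U \<Longrightarrow> x \<inter> y = {} \<Longrightarrow> f (\<phi> x) (\<psi> y) = b"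
    and inter: "\<And>x y. x \<subseteq> U \<Longrightarrow> y \<subseteq> U \<Longrightarrow> card (x \<inter> y) = 1 \<Longrightarrow> f (\<phi> x) (\<psi> y) = (\<not> b)"
  shows "card U \<le> 576 * cost P"
proof -
  interpret coins: prob_space coin_space by (rule prob_space_coin_space)
  have meas: "measurable_protocol P"
    using P by (simp add: computes_def)
  define q :: "'a set \<Rightarrow> 'a set \<Rightarrow> coins \<Rightarrow> real"
    where "q x y r = of_bool (run P (\<phi> x) r (\<psi> y) r = b)" for x y r
  define pr where "pr x y = \<P>(r in coin_space. run P (\<phi> x) r (\<psi> y) r = b)" for x y
  have sets: "{r \<in> space coin_space. run P x r y r = c} \<in> sets coin_space" for x y c
    using measurable_run_diagonal[OF meas, of x y] by measurable
  have q_eq: "q x y r = indicator {r \<in> space coin_space. run P (\<phi> x) r (\<psi> y) r = b} r"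
    if "r \<in> space coin_space" for x y r
    using that by (simp add: q_def indicator_def)
  have q_int: "integrable coin_space (q x y)" for x y
    using sets[of "\<phi> x" "\<psi> y" b]
    by (subst Bochner_Integration.integrable_cong[OF refl q_eq]) (auto simp: less_top[symmetric])
  have q_exp: "coins.expectation (q x y) = pr x y" for x y
    unfolding pr_def
    by (subst Bochner_Integration.integral_cong[OF refl q_eq]) (use sets in auto)
  have success: "\<P>(r in coin_space. run P (\<phi> x) r (\<psi> y) r = f (\<phi> x) (\<psi> y)) \<ge> 2/3"
    if "x \<subseteq> U" "y \<subseteq> U" for x y
    using P that len prob_run_public_coins[OF meas] by (auto simp: computes_def)
  have pr_disj: "pr x y \<ge> 2/3" if "x \<subseteq> U" "y \<subseteq> U" "x \<inter> y = {}" for x y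
    using success[OF that(1,2)] disj[OF that] by (simp add: pr_def)
  have pr_inter: "pr x y \<le> 1/3" if "x \<subseteq> U" "y \<subseteq> U" "card (x \<inter> y) = 1" for x y
  proof -
    have "{r \<in> space coin_space. run P (\<phi> x) r (\<psi> y) r = (\<not> b)}
        = space coin_space - {r \<in> space coin_space. run P (\<phi> x) r (\<psi> y) r = b}"
      by auto
    then show ?thesis
      using success[OF that(1,2)] inter[OF that] coins.prob_compl[OF sets, of "\<phi> x" "\<psi> y" b]
      by (simp add: pr_def)
  qed
  define g where "g r = (\<Sum>i\<in>U. \<Sum>e\<in>Pow (U - {i}). \<Sum>z\<in>Pow (U - {i}).
      q (z \<inter> e) (z - e) r - q (insert i (z \<inter> e)) (insert i (z - e)) r)" for r
  define c where "c = card U * (2 ^ (card U - 1))\<^sup>2 / (3 :: real)"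
  \<comment> \<open>The pair \<open>z \<inter> e\<close>, \<open>z - e\<close> is disjoint, and
    inserting \<open>i\<close> on both sides makes it the only common element. So the probabilities
    of answer \<open>b\<close> differ by at least 2/3 - 1/3.\<close>
  have "c = (\<Sum>i\<in>U. \<Sum>e\<in>Pow (U - {i}). \<Sum>z\<in>Pow (U - {i}). 2/3 - 1/3)"
    using \<open>finite U\<close> by (simp add: c_def card_Pow power2_eq_square)
  also have "\<dots> \<le> (\<Sum>i\<in>U. \<Sum>e\<in>Pow (U - {i}). \<Sum>z\<in>Pow (U - {i}).
      pr (z \<inter> e) (z - e) - pr (insert i (z \<inter> e)) (insert i (z - e)))"
  proof (intro sum_mono diff_mono pr_disj pr_inter)
    fix i e z assume "i \<in> U" "e \<in> Pow (U - {i})" "z \<in> Pow (U - {i})"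
    then have eq: "insert i (z \<inter> e) \<inter> insert i (z - e) = {i}"
      by auto
    show "card (insert i (z \<inter> e) \<inter> insert i (z - e)) = 1"
      unfolding eq by simp
  qed auto
  also have "\<dots> = coins.expectation g"
    unfolding g_def using q_int by (simp add: q_exp)
  finally have E: "c \<le> coins.expectation g" .
  have "integrable coin_space g"
    unfolding g_def by (intro Bochner_Integration.integrable_sum Bochner_Integration.integrable_diff q_int)
  then have "\<not> (AE r in coin_space. g r < c)"
    using E coins.expectation_less[of g c] by auto
  then obtain r where r: "c \<le> g r"
    by (metis AE_I2 not_le)
  obtain I :: "bool list set" and A B leaf out where "is_transcript_partition P r r I A B leaf out"
    using transcript_partition_exists[of P r r] by blast
  then have I: "finite I" "card I \<le> 2 ^ cost P"
    and leaf: "\<And>x y. leaf x y \<in> I" "\<And>x y. A (leaf x y) x" "\<And>x y. B (leaf x y) y"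
      "\<And>x y t. t \<in> I \<Longrightarrow> A t x \<Longrightarrow> B t y \<Longrightarrow> t = leaf x y"
    and run: "\<And>x y. run P x r y r = out (leaf x y)"
    unfolding is_transcript_partition_def by blast+
  interpret rectangle_partition U I "\<lambda>t x. A t (\<phi> x)" "\<lambda>t y. B t (\<psi> y)"
  proof
    show "\<exists>!t. t \<in> I \<and> A t (\<phi> x) \<and> B t (\<psi> y)" for x y
      using leaf by (intro ex1I[of _ "leaf (\<phi> x) (\<psi> y)"]) auto
  qed (use \<open>finite U\<close> I(1) in auto)
  define J where "J = {t \<in> I. out t = b}"
  have J: "J \<subseteq> I"
    by (auto simp: J_def)
  have cell: "of_bool (\<exists>t\<in>J. A t (\<phi> x) \<and> B t (\<psi> y)) = q x y r" for x y
  proof -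
    have "(\<exists>t\<in>J. A t (\<phi> x) \<and> B t (\<psi> y)) \<longleftrightarrow> leaf (\<phi> x) (\<psi> y) \<in> J"
      using leaf J by (metis subsetD)
    then show ?thesis
      using leaf(1) run by (simp add: J_def q_def)
  qed
  have "(\<Sum>i\<in>U. \<Sum>e\<in>Pow (U - {i}). advantage J i e) = g r"
    unfolding g_def by (intro sum.cong refl) (simp add: advantage_eq J cell del: of_bool_eq)
  then have "card U \<le> 576 * ln (card I)"
    using r J by (intro card_le_ln_card_cells) (auto simp: c_def)
  also have "\<dots> \<le> 576 * real (cost P)"
  proof -
    have "card I > 0"
      using I(1) leaf(1) by (auto simp: card_gt_0_iff)
    moreover have "real (card I) \<le> 2 ^ cost P"
      using of_nat_mono[OF I(2), where 'a = real] by simp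
    ultimately have "ln (card I) \<le> ln (2 ^ cost P :: real)"
      by (subst ln_le_cancel_iff) auto
    also have "\<dots> = cost P * ln 2"
      by (rule ln_realpow)
    also have "\<dots> \<le> real (cost P) * 1"
      using ln_2_less_1 by (intro mult_left_mono) auto
    finally show ?thesis
      by simp
  qed
  finally have "real (card U) \<le> real (576 * cost P)"
    by simp
  then show ?thesis
    by (simp only: of_nat_le_iff)
qed

section \<open>Jumps of the outer function\<close>

definition hamming :: "bool list \<Rightarrow> bool list \<Rightarrow> nat" where
  "hamming x y = card {i. i < length x \<and> x ! i \<noteq> y ! i}"

definition matches :: "bool \<Rightarrow> bool \<Rightarrow> bool list \<Rightarrow> bool list \<Rightarrow> nat" where
  "matches \<alpha> \<beta> x y = card {i. i < length x \<and> x ! i = \<alpha> \<and> y ! i = \<beta>}"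

text \<open>The last \<open>l\<close> coordinates always match and the first \<open>n - l\<close>
  carry the sets: disjoint sets give \<open>l\<close> matches, one common element gives
  \<open>l + 1\<close>. A jump at \<open>l\<close> thus decides unique disjointness on
  \<open>n - l\<close> elements.\<close>

lemma AND_jump_bound:
  assumes P: "computes public_coins n f P"
    and f: "\<And>x y. length x = n \<Longrightarrow> length y = n \<Longrightarrow> f x y = G (matches \<alpha> \<beta> x y)"
    and jump: "l < n" "G l \<noteq> G (Suc l)"
  shows "n - l \<le> 576 * cost P"
proof -
  define m where "m = n - l"
  define emb where "emb \<gamma> x = map (\<lambda>i. if i < m \<and> i \<notin> x then \<not> \<gamma> else \<gamma>) [0..<n]" for \<gamma> x
  have emb: "length (emb \<gamma> x) = n" "i < n \<Longrightarrow> emb \<gamma> x ! i = \<gamma> \<longleftrightarrow> (i < m \<longrightarrow> i \<in> x)" for \<gamma> x i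
    by (auto simp: emb_def)
  have count: "matches \<alpha> \<beta> (emb \<alpha> x) (emb \<beta> y) = card (x \<inter> y) + l"
    if xy: "x \<subseteq> {..<m}" "y \<subseteq> {..<m}" for x y
  proof -
    have "{i. i < n \<and> emb \<alpha> x ! i = \<alpha> \<and> emb \<beta> y ! i = \<beta>}
        = {i. i < n \<and> (i < m \<longrightarrow> i \<in> x) \<and> (i < m \<longrightarrow> i \<in> y)}"
      by (intro Collect_cong conj_cong refl) (simp_all add: emb)
    also have "\<dots> = (x \<inter> y) \<union> {m..<n}"
    proof -
      have "i < m \<Longrightarrow> i < n" for i
        by (simp add: m_def)
      then show ?thesis
        using xy by (auto simp: subset_iff not_less)
    qed
    finally have "{i. i < n \<and> emb \<alpha> x ! i = \<alpha> \<and> emb \<beta> y ! i = \<beta>} = (x \<inter> y) \<union> {m..<n}" .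
    moreover have "card ((x \<inter> y) \<union> {m..<n}) = card (x \<inter> y) + card {m..<n}"
      using xy by (intro card_Un_disjoint) (auto intro: finite_subset)
    ultimately show ?thesis
      using jump by (simp add: matches_def emb m_def)
  qed
  have "card {..<m} \<le> 576 * cost P"
    by (rule unique_disjointness_bound[OF P, of _ "emb \<alpha>" "emb \<beta>" "G l"])
       (use jump in \<open>auto simp: emb f count\<close>)
  then show ?thesis
    by (simp add: m_def)
qed

text \<open>Disjoint sets are placed at distance \<open>i + 2\<close> and sets with one common
  element at distance \<open>i\<close>. The conditions on \<open>m\<close> make the padding
  \<open>i + 2 - 2 * m\<close> nonnegative and let gadgets and padding fit into \<open>n\<close>
  coordinates.\<close>

lemma XOR_jump_bound:
  assumes P: "computes public_coins n f P"
    and f: "\<And>x y. length x = n \<Longrightarrow> length y = n \<Longrightarrow> f x y = G (hamming x y)"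
    and jump: "G i \<noteq> G (i + 2)" and m: "2 * m \<le> i + 2" "m + (i + 2) \<le> n"
  shows "m \<le> 576 * cost P"
proof -
  \<comment> \<open>Element \<open>j\<close> becomes the coordinates \<open>j\<close>, \<open>m + j\<close>, \<open>2 m + j\<close>, filled with \<open>(x, \<not> x, 0)\<close> by Alice and
    \<open>(y, 0, \<not> y)\<close> by Bob: these are at distance 0 if \<open>x = y = 1\<close> and at distance 2 otherwise. Further
    \<open>w\<close> coordinates always differ.\<close>
  define w where "w = i + 2 - 2 * m"
  define ea where "ea x = map (\<lambda>j. if j < m then j \<in> x else if j < 2 * m then j - m \<notin> x
      else 3 * m \<le> j \<and> j < 3 * m + w) [0..<n]" for x
  define eb where "eb y = map (\<lambda>j. if j < m then j \<in> y else 2 * m \<le> j \<and> j < 3 * m \<and> j - 2 * m \<notin> y) [0..<n]"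
    for y
  have len: "length (ea x) = n" "length (eb x) = n" for x
    by (simp_all add: ea_def eb_def)
  have ham: "hamming (ea x) (eb y) = i + 2 - 2 * card (x \<inter> y)"
    if xy: "x \<subseteq> {..<m}" "y \<subseteq> {..<m}" for x y
  proof -
    have fin: "finite x" "finite y"
      using xy finite_subset by auto
    have "{j. j < n \<and> ea x ! j \<noteq> eb y ! j} = ((x - y) \<union> (y - x)) \<union> (\<lambda>j. m + j) ` ({..<m} - x)
        \<union> (\<lambda>j. 2 * m + j) ` ({..<m} - y) \<union> {3 * m..<3 * m + w}" (is "?L = ?R")
    proof (rule set_eqI)
      fix j
      have 1: "j \<in> (\<lambda>j. m + j) ` ({..<m} - x) \<longleftrightarrow> m \<le> j \<and> j < 2 * m \<and> j - m \<notin> x"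
        by (auto simp: image_iff intro!: bexI[of _ "j - m"])
      have 2: "j \<in> (\<lambda>j. 2 * m + j) ` ({..<m} - y) \<longleftrightarrow> 2 * m \<le> j \<and> j < 3 * m \<and> j - 2 * m \<notin> y"
        by (auto simp: image_iff intro!: bexI[of _ "j - 2 * m"])
      have 3: "3 * m + w \<le> n"
        using m by (simp add: w_def)
      show "j \<in> ?L \<longleftrightarrow> j \<in> ?R"
        using xy 3 unfolding Un_iff 1 2 by (auto simp: ea_def eb_def subset_iff)
    qed
    then have "hamming (ea x) (eb y) = card ?R"
      by (simp add: hamming_def ea_def)
    also have "\<dots> = card (x - y) + card (y - x) + card ((\<lambda>j. m + j) ` ({..<m} - x))
        + card ((\<lambda>j. 2 * m + j) ` ({..<m} - y)) + card {3 * m..<3 * m + w}"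
      by (subst card_Un_disjoint; (use xy fin in \<open>force\<close>)?)+
    also have "\<dots> = card (x - y) + card (y - x) + (m - card x) + (m - card y) + w"
      using xy fin by (simp add: card_image card_Diff_subset)
    also have "\<dots> = i + 2 - 2 * card (x \<inter> y)"
    proof -
      have "card (x - y) + card (x \<inter> y) = card x" "card (y - x) + card (x \<inter> y) = card y"
        using fin by (metis add.commute card_Int_Diff Int_commute)+
      moreover have "card x \<le> m" "card y \<le> m"
        using xy card_mono[of "{..<m}"] by force+
      ultimately show ?thesis
        using m by (simp add: w_def)
    qed
    finally show ?thesis .
  qed
  have "card {..<m} \<le> 576 * cost P"
    by (rule unique_disjointness_bound[OF P, of _ ea eb "G (i + 2)"])
       (use jump in \<open>auto simp: ham f len\<close>)
  then show ?thesis
    by simp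
qed

section \<open>Normal forms of the inner gate\<close>

lemma count_list_eq_card_nth: "count_list xs a = card {i. i < length xs \<and> xs ! i = a}"
  by (simp add: count_list_eq_length_filter length_filter_conv_card eq_commute)

lemma symmetric_fn_cong:
  assumes "symmetric_fn n \<sigma>" "length u = n" "length v = n" "count_list u True = count_list v True"
  shows "\<sigma> u = \<sigma> v"
proof -
  have "count_list w False = length w - count_list w True" for w
    by (induction w) (auto simp: Suc_diff_le count_le_length)
  then have "count_list u b = count_list v b" for b
    using assms by (cases b) auto
  then have "mset u = mset v"
    by (intro multiset_eqI) (simp flip: count_mset)
  then obtain p where "p permutes {..<length v}" "permute_list p v = u"
    using mset_eq_permutation by metis
  then show ?thesis
    using assms unfolding symmetric_fn_def by metis
qed

text \<open>Lets a negation of the gate be absorbed into the outer function of the count.\<close>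

lemma card_less_neq:
  "card {i. i < n \<and> (p i \<noteq> \<gamma>)} = (if \<gamma> then n - card {i. i < n \<and> p i} else card {i. i < n \<and> p i})"
proof (cases \<gamma>)
  case True
  have "{i. i < n \<and> (p i \<noteq> \<gamma>)} = {..<n} - {i. i < n \<and> p i}"
    using True by auto
  then show ?thesis
    using True by (simp add: card_Diff_subset subset_iff)
qed simp

text \<open>A truth table with an odd number of true entries is a conjunction of literals or its
  negation; one with an even number is XOR, its negation, or a function of one argument.\<close>

lemma binary_gate_cases:
  fixes h :: "bool \<Rightarrow> bool \<Rightarrow> bool"
  obtains (left) "\<And>a b. h a b = h a True" | (right) "\<And>a b. h a b = h True b"
    | (xor) \<gamma> where "\<And>a b. h a b = ((a \<noteq> b) \<noteq> \<gamma>)"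
    | (conj) \<alpha> \<beta> \<gamma> where "\<And>a b. h a b = ((a = \<alpha> \<and> b = \<beta>) \<noteq> \<gamma>)"
proof -
  have "(\<forall>a b. h a b = h a True) \<or> (\<forall>a b. h a b = h True b) \<or> (\<exists>\<gamma>. \<forall>a b. h a b = ((a \<noteq> b) \<noteq> \<gamma>))
      \<or> (\<exists>\<alpha> \<beta> \<gamma>. \<forall>a b. h a b = ((a = \<alpha> \<and> b = \<beta>) \<noteq> \<gamma>))"
    unfolding all_bool_eq ex_bool_eq
    by (cases "h True True"; cases "h True False"; cases "h False True"; cases "h False False") simp_all
  then show ?thesis
  proof (elim disjE exE)
    assume "\<forall>a b. h a b = h a True"
    then show ?thesis by (intro that(1)) (rule spec, erule spec)
  next
    assume "\<forall>a b. h a b = h True b"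
    then show ?thesis by (intro that(2)) (rule spec, erule spec)
  next
    fix \<gamma> assume "\<forall>a b. h a b = ((a \<noteq> b) \<noteq> \<gamma>)"
    then show ?thesis by (intro that(3)) (rule spec, erule spec)
  next
    fix \<alpha> \<beta> \<gamma> assume "\<forall>a b. h a b = ((a = \<alpha> \<and> b = \<beta>) \<noteq> \<gamma>)"
    then show ?thesis by (intro that(4)) (rule spec, erule spec)
  qed
qed

lemma strongly_perm_invariant_cases:
  assumes "strongly_perm_invariant n f"
  obtains (left) F where "\<And>x y. length x = n \<Longrightarrow> length y = n \<Longrightarrow> f x y = F x"
    | (right) F where "\<And>x y. length x = n \<Longrightarrow> length y = n \<Longrightarrow> f x y = F y"
    | (xor) G where "\<And>x y. length x = n \<Longrightarrow> length y = n \<Longrightarrow> f x y = G (hamming x y)"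
    | (conj) G \<alpha> \<beta> where "\<And>x y. length x = n \<Longrightarrow> length y = n \<Longrightarrow> f x y = G (matches \<alpha> \<beta> x y)"
proof -
  obtain \<sigma> h where \<sigma>: "symmetric_fn n \<sigma>"
    and f: "\<And>x y. length x = n \<Longrightarrow> length y = n \<Longrightarrow> f x y = \<sigma> (map2 h x y)"
    using assms unfolding strongly_perm_invariant_def by blast
  \<comment> \<open>The sorted list represents all lists with \<open>c\<close> true entries, which a
    symmetric function cannot tell apart.\<close>
  define G where "G c = \<sigma> (replicate c True @ replicate (n - c) False)" for c
  have count: "count_list (map2 h x y) True = card {i. i < n \<and> h (x ! i) (y ! i)}"
    if "length x = n" "length y = n" for x y
    unfolding count_list_eq_card_nth using that
    by (intro arg_cong[where f = card] Collect_cong) auto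
  have G: "f x y = G (card {i. i < n \<and> h (x ! i) (y ! i)})" if xy: "length x = n" "length y = n" for x y
  proof -
    have "card {i. i < n \<and> h (x ! i) (y ! i)} \<le> card {..<n}"
      by (intro card_mono) auto
    moreover have "count_list (replicate c True @ replicate (n - c) False) True = c" for c
      by (simp add: count_list_eq_length_filter)
    ultimately show ?thesis
      unfolding f[OF xy] G_def using \<sigma> xy count[OF xy] by (intro symmetric_fn_cong) auto
  qed
  show ?thesis
  proof (cases h rule: binary_gate_cases)
    case left
    show ?thesis
      by (rule that(1)[of "\<lambda>x. G (card {i. i < n \<and> h (x ! i) True})"]) (subst G, assumption, assumption, intro arg_cong[where f = G] arg_cong[where f = card] Collect_cong conj_cong refl left)
  next
    case right
    show ?thesis
      by (rule that(2)[of "\<lambda>y. G (card {i. i < n \<and> h True (y ! i)})"]) (subst G, assumption, assumption, intro arg_cong[where f = G] arg_cong[where f = card] Collect_cong conj_cong refl right)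
  next
    case (xor \<gamma>)
    show ?thesis
      by (rule that(3)[of "\<lambda>c. G (if \<gamma> then n - c else c)"])
         (subst G, assumption, assumption, simp only: xor hamming_def card_less_neq)
  next
    case (conj \<alpha> \<beta> \<gamma>)
    show ?thesis
      by (rule that(4)[of "\<lambda>c. G (if \<gamma> then n - c else c)" \<alpha> \<beta>])
         (subst G, assumption, assumption, simp only: conj matches_def card_less_neq)
  qed
qed

section \<open>Functions of finitely many independent coins\<close>

text \<open>Used with a finite \<open>K\<close> and finite-valued coins, where it implies
  measurability and integrability, and independence when the sets \<open>K\<close> are disjoint. The
  sketches below are of this kind.\<close>

definition depends_on :: "(('i \<Rightarrow> 'a) \<Rightarrow> 'b) \<Rightarrow> 'i set \<Rightarrow> bool" where
  "depends_on f K \<longleftrightarrow> (\<forall>w w'. (\<forall>k\<in>K. w k = w' k) \<longrightarrow> f w = f w')"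

lemma depends_onD: "depends_on f K \<Longrightarrow> (\<And>k. k \<in> K \<Longrightarrow> w k = w' k) \<Longrightarrow> f w = f w'"
  by (simp add: depends_on_def)

lemma depends_on_compose: "depends_on f K \<Longrightarrow> depends_on (\<lambda>w. g (f w)) K"
  by (auto simp: depends_on_def) metis

lemma depends_on_compose2:
  assumes "depends_on f K" "depends_on g L"
  shows "depends_on (\<lambda>w. h (f w) (g w)) (K \<union> L)"
proof -
  have "f w = f w' \<and> g w = g w'" if "\<forall>k\<in>K \<union> L. w k = w' k" for w w'
    using that assms by (auto intro: depends_onD)
  then show ?thesis
    unfolding depends_on_def by metis
qed

lemma depends_on_finite_range:
  fixes f :: "('i \<Rightarrow> 'a :: finite) \<Rightarrow> 'b"
  assumes "depends_on f K" "finite K"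
  shows "finite (range f)"
proof -
  have "f w = f (restrict w K)" for w
    using assms(1) by (rule depends_onD) simp
  then have "range f \<subseteq> f ` (K \<rightarrow>\<^sub>E UNIV)"
    by (metis PiE_UNIV_domain image_eqI image_subsetI restrict_PiE_iff UNIV_I)
  moreover have "finite (K \<rightarrow>\<^sub>E (UNIV :: 'a set))"
    using assms(2) by (intro finite_PiE) auto
  ultimately show ?thesis
    using finite_subset by blast
qed

lemma measurable_depends_on:
  fixes f :: "('i \<Rightarrow> 'a :: finite) \<Rightarrow> 'b"
  assumes "depends_on f K" "finite K" "K \<subseteq> I" and N: "range f \<subseteq> space N"
  shows "f \<in> PiM I (\<lambda>_. measure_pmf p) \<rightarrow>\<^sub>M N"
proof -
  \<comment> \<open>On finitely many finite-valued coins the product sigma-algebra is discrete, so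
    every function of them is measurable.\<close>
  have "sets (PiM K (\<lambda>_. measure_pmf p)) = sets (PiM K (\<lambda>_. count_space UNIV))"
    by (intro sets_PiM_cong) auto
  also have "PiM K (\<lambda>_. count_space (UNIV :: 'a set)) = count_space (K \<rightarrow>\<^sub>E UNIV)"
    using assms(2) by (intro count_space_PiM_finite) (auto simp: countable_finite)
  finally have sets: "sets (PiM K (\<lambda>_. measure_pmf p)) = sets (count_space (K \<rightarrow>\<^sub>E UNIV))" .
  have "f \<in> PiM K (\<lambda>_. measure_pmf p) \<rightarrow>\<^sub>M N"
    using N by (subst measurable_cong_sets[OF sets refl]) auto
  then have "(\<lambda>w. f (restrict w K)) \<in> PiM I (\<lambda>_. measure_pmf p) \<rightarrow>\<^sub>M N"
    using assms(3) by (intro measurable_compose[OF measurable_restrict_subset])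
  moreover have "f w = f (restrict w K)" for w
    using assms(1) by (rule depends_onD) simp
  ultimately show ?thesis
    by simp
qed

context
  fixes p :: "'a :: finite pmf" and M
  defines "M \<equiv> PiM (UNIV :: 'i set) (\<lambda>_. measure_pmf p)"
begin

interpretation prob_space M
  unfolding M_def by (rule prob_space_PiM) (rule measure_pmf.prob_space_axioms)

lemma integrable_depends_on:
  fixes f :: "('i \<Rightarrow> 'a) \<Rightarrow> real"
  assumes "depends_on f K" "finite K"
  shows "integrable M f"
proof (rule integrable_const_bound)
  have "finite ((\<lambda>x. \<bar>x\<bar>) ` range f)"
    using depends_on_finite_range[OF assms] by blast
  then show "AE w in M. norm (f w) \<le> Max ((\<lambda>x. \<bar>x\<bar>) ` range f)"
    by (intro AE_I2) (simp add: image_image)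
  show "f \<in> borel_measurable M"
    unfolding M_def using assms by (intro measurable_depends_on) auto
qed

lemma indep_vars_coordinates: "indep_vars (\<lambda>_. measure_pmf p) (\<lambda>i w. w i) (UNIV :: 'i set)"
proof -
  have "distr M (PiM UNIV (\<lambda>_. measure_pmf p)) (\<lambda>w. \<lambda>i\<in>UNIV. w i) = M"
    by (simp add: M_def restrict_def)
  moreover have "distr M (measure_pmf p) (\<lambda>w. w i) = measure_pmf p" for i
    unfolding M_def by (rule distr_PiM_component) (auto intro: measure_pmf.prob_space_axioms)
  ultimately show ?thesis
    by (subst indep_vars_iff_distr_eq_PiM') (auto simp: M_def)
qed

lemma expectation_mult_depends_on:
  fixes f g :: "('i \<Rightarrow> 'a) \<Rightarrow> real"
  assumes f: "depends_on f K" "finite K" and g: "depends_on g L" "finite L" and "K \<inter> L = {}"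
  shows "expectation (\<lambda>w. f w * g w) = expectation f * expectation g"
proof -
  have restr: "f = f \<circ> (\<lambda>w. restrict w K)" "g = g \<circ> (\<lambda>w. restrict w L)"
    using f g by (auto simp: fun_eq_iff intro: depends_onD)
  have "indep_var borel (f \<circ> (\<lambda>w. restrict w K)) borel (g \<circ> (\<lambda>w. restrict w L))"
    using \<open>K \<inter> L = {}\<close>
    by (intro indep_var_compose[OF indep_var_restrict[OF indep_vars_coordinates]]
          measurable_depends_on[OF f] measurable_depends_on[OF g]) auto
  then show ?thesis
    using restr integrable_depends_on f g by (intro indep_var_lebesgue_integral) auto
qed

lemma expectation_coordinate:
  fixes g :: "'a \<Rightarrow> real"
  shows "expectation (\<lambda>w. g (w i)) = measure_pmf.expectation p g"
proof -
  have "distr M (measure_pmf p) (\<lambda>w. w i) = measure_pmf p"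
    unfolding M_def by (rule distr_PiM_component) (auto intro: measure_pmf.prob_space_axioms)
  then have "measure_pmf.expectation p g = (\<integral>x. g x \<partial>(distr M (measure_pmf p) (\<lambda>w. w i)))"
    by simp
  also have "\<dots> = expectation (\<lambda>w. g (w i))"
    by (rule integral_distr) (auto simp: M_def)
  finally show ?thesis ..
qed

text \<open>Chebyshev's inequality: disjoint coin sets make the cross terms of the centred variables
  vanish, and each variance is at most the second moment.\<close>

lemma prob_sum_deviation_le:
  fixes X :: "nat \<Rightarrow> ('i \<Rightarrow> 'a) \<Rightarrow> real"
  assumes X: "\<And>j. depends_on (X j) (K j)" and fin: "\<And>j. finite (K j)"
    and disj: "\<And>j l. j \<noteq> l \<Longrightarrow> K j \<inter> K l = {}"
    and second: "\<And>j. expectation (\<lambda>w. (X j w)\<^sup>2) \<le> V" and "a > 0"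
  shows "prob {w \<in> space M. \<bar>\<Sum>j<T. X j w - expectation (X j)\<bar> \<ge> a} \<le> T * V / a\<^sup>2"
proof -
  define Y where "Y j w = X j w - expectation (X j)" for j w
  define f where "f w = (\<Sum>j<T. Y j w)" for w
  have int: "integrable M (X j)" for j
    using X fin by (rule integrable_depends_on)
  have Y: "depends_on (Y j) (K j)" for j
    unfolding Y_def using X by (rule depends_on_compose)
  have EY: "expectation (Y j) = 0" for j
    unfolding Y_def using int by (simp add: prob_space)
  have intY: "integrable M (\<lambda>w. Y j w * Y l w)" for j l
    by (rule integrable_depends_on[OF depends_on_compose2[OF Y Y]]) (use fin in auto)
  have EYY: "expectation (\<lambda>w. Y j w * Y l w) \<le> (if j = l then V else 0)" for j l
  proof (cases "j = l")
    case True
    have "expectation (\<lambda>w. Y j w * Y j w) = variance (X j)"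
      by (simp add: Y_def power2_eq_square)
    also have "\<dots> = expectation (\<lambda>w. (X j w)\<^sup>2) - (expectation (X j))\<^sup>2"
      by (intro variance_eq int integrable_depends_on[OF depends_on_compose[OF X] fin])
    also have "\<dots> \<le> V"
      using second[of j] zero_le_power2[of "expectation (X j)"] by linarith
    finally show ?thesis
      using True by simp
  next
    case False
    then show ?thesis
      using expectation_mult_depends_on[OF Y fin Y fin disj] EY by simp
  qed
  have f_eq: "(f w)\<^sup>2 = (\<Sum>j<T. \<Sum>l<T. Y j w * Y l w)" for w
    by (simp add: f_def power2_eq_square sum_product)
  have intf: "integrable M (\<lambda>w. (f w)\<^sup>2)"
    unfolding f_eq by (intro Bochner_Integration.integrable_sum intY)
  have "expectation (\<lambda>w. (f w)\<^sup>2) = (\<Sum>j<T. \<Sum>l<T. expectation (\<lambda>w. Y j w * Y l w))"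
    unfolding f_eq by (simp add: intY)
  also have "\<dots> \<le> (\<Sum>j<T. \<Sum>l<T. if j = l then V else 0)"
    by (intro sum_mono EYY)
  also have "\<dots> = T * V"
    by simp
  finally have Ef2: "expectation (\<lambda>w. (f w)\<^sup>2) \<le> T * V" .
  have fY: "integrable M (Y j)" for j
    by (rule integrable_depends_on[OF Y fin])
  have Ef: "expectation f = 0"
    unfolding f_def using fY EY by simp
  have "prob {w \<in> space M. \<bar>f w - expectation f\<bar> \<ge> a} \<le> variance f / a\<^sup>2"
    using intf \<open>a > 0\<close> fY by (intro Chebyshev_inequality) (auto simp: f_def)
  also have "\<dots> \<le> T * V / a\<^sup>2"
    using Ef2 by (intro divide_right_mono) (auto simp: Ef)
  finally show ?thesis
    by (simp add: Ef) (simp add: f_def Y_def)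
qed

end

section \<open>Rademacher sums over imperfectly shared signs\<close>

definition pm :: "bool \<Rightarrow> real" where
  "pm b = (if b then 1 else -1)"

lemma expectation_isr_fst:
  fixes g :: "bool \<Rightarrow> real"
  shows "measure_pmf.expectation (isr_pair \<rho>) (\<lambda>z. g (fst z)) = (g True + g False) / 2"
proof -
  have "measure_pmf.expectation (isr_pair \<rho>) (\<lambda>z. g (fst z))
      = measure_pmf.expectation (map_pmf fst (isr_pair \<rho>)) g"
    by simp
  then show ?thesis
    unfolding map_fst_isr_pair by (simp add: integral_bernoulli_pmf field_simps)
qed

lemma expectation_isr_snd:
  fixes g :: "bool \<Rightarrow> real"
  shows "measure_pmf.expectation (isr_pair \<rho>) (\<lambda>z. g (snd z)) = (g True + g False) / 2"
proof -
  have "measure_pmf.expectation (isr_pair \<rho>) (\<lambda>z. g (snd z))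
      = measure_pmf.expectation (map_pmf snd (isr_pair \<rho>)) g"
    by simp
  then show ?thesis
    unfolding map_snd_isr_pair by (simp add: integral_bernoulli_pmf field_simps)
qed

lemma expectation_isr_correlation:
  assumes "0 \<le> \<rho>" "\<rho> \<le> 1"
  shows "measure_pmf.expectation (isr_pair \<rho>) (\<lambda>z. pm (fst z) * pm (snd z)) = \<rho>"
proof -
  have "(\<lambda>z. pm (fst z) * pm (snd z)) = (\<lambda>z. 2 * indicator {(r, s). r = s} z - 1)"
    by (auto simp: pm_def fun_eq_iff)
  moreover have "integrable (measure_pmf (isr_pair \<rho>)) (indicator {(r, s). r = s} :: _ \<Rightarrow> real)"
    by (intro integrable_measure_pmf_finite finite)
  ultimately show ?thesis
    using prob_agree_isr_pair[OF assms] by (simp add: field_simps)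
qed

abbreviation isr_space :: "real \<Rightarrow> (nat \<Rightarrow> bool \<times> bool) measure" where
  "isr_space \<rho> \<equiv> PiM UNIV (\<lambda>_. measure_pmf (isr_pair \<rho>))"

lemma integrable_isr:
  fixes f :: "(nat \<Rightarrow> bool \<times> bool) \<Rightarrow> real"
  shows "depends_on f K \<Longrightarrow> finite K \<Longrightarrow> integrable (isr_space \<rho>) f"
  by (rule integrable_depends_on)

text \<open>The degree-4 term \<open>x ^ 4 / 24\<close> of the series of \<open>cosh\<close>, all of
  whose terms are nonnegative.\<close>

lemma fourth_power_le_exp: "x ^ 4 \<le> 12 * (exp x + exp (- x))" for x :: real
proof -
  let ?f = "\<lambda>n. if even n then x ^ n /\<^sub>R fact n else 0"
  have f: "summable ?f" "suminf ?f = cosh x"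
    using cosh_converges[of x] by (simp_all add: sums_iff)
  have "(\<Sum>n\<in>{4}. ?f n) \<le> suminf ?f"
    by (intro sum_le_suminf f(1)) (auto simp: zero_le_even_power)
  then show ?thesis
    unfolding f(2) by (simp add: cosh_field_def fact_numeral field_simps)
qed

lemma square_le_exp: "x\<^sup>2 \<le> exp x + exp (- x)" for x :: real
proof -
  let ?f = "\<lambda>n. if even n then x ^ n /\<^sub>R fact n else 0"
  have f: "summable ?f" "suminf ?f = cosh x"
    using cosh_converges[of x] by (simp_all add: sums_iff)
  have "(\<Sum>n\<in>{2}. ?f n) \<le> suminf ?f"
    by (intro sum_le_suminf f(1)) (auto simp: zero_le_even_power)
  then show ?thesis
    unfolding f(2) by (simp add: cosh_field_def fact_numeral field_simps)
qed

text \<open>The selector \<open>c\<close> is \<open>fst\<close> for Alice's copy of the signs and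
  \<open>snd\<close> for Bob's.\<close>

definition rademacher ::
    "(bool \<times> bool \<Rightarrow> bool) \<Rightarrow> nat set \<Rightarrow> (nat \<Rightarrow> real) \<Rightarrow> (nat \<Rightarrow> bool \<times> bool) \<Rightarrow> real" where
  "rademacher c K u w = (\<Sum>k\<in>K. u k * pm (c (w k)))"

lemma depends_on_rademacher: "depends_on (rademacher c K u) K"
  by (simp add: depends_on_def rademacher_def)

context
  fixes \<rho> :: real and c :: "bool \<times> bool \<Rightarrow> bool" and M
  defines "M \<equiv> isr_space \<rho>"
  assumes half: "\<And>g :: bool \<Rightarrow> real. measure_pmf.expectation (isr_pair \<rho>) (\<lambda>z. g (c z)) = (g True + g False) / 2"
begin

interpretation prob_space M
  unfolding M_def by (rule prob_space_PiM) (rule measure_pmf.prob_space_axioms)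

text \<open>By independence each coin contributes a factor \<open>cosh (u k)\<close>. The bound
  depends on the norm of \<open>u\<close> but not on the size of \<open>K\<close>.\<close>

lemma expectation_exp_rademacher_le:
  assumes "finite K"
  shows "expectation (\<lambda>w. exp (rademacher c K u w)) \<le> exp ((\<Sum>k\<in>K. (u k)\<^sup>2) / 2)"
  using assms
proof (induction K)
  case empty
  then show ?case by (simp add: rademacher_def prob_space)
next
  case (insert k K)
  have "expectation (\<lambda>w. exp (rademacher c (insert k K) u w))
      = expectation (\<lambda>w. exp (u k * pm (c (w k))) * exp (rademacher c K u w))"
    using insert by (simp add: rademacher_def exp_add)
  also have "\<dots> = expectation (\<lambda>w. exp (u k * pm (c (w k)))) * expectation (\<lambda>w. exp (rademacher c K u w))"
    unfolding M_def
    by (rule expectation_mult_depends_on[where K = "{k}" and L = K])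
       (use insert in \<open>auto simp: depends_on_def rademacher_def\<close>)
  also have "expectation (\<lambda>w. exp (u k * pm (c (w k)))) = (exp (u k) + exp (- u k)) / 2"
    unfolding M_def using half[of "\<lambda>b. exp (u k * pm b)"]
    by (subst expectation_coordinate[where g = "\<lambda>z. exp (u k * pm (c z))"]) (simp add: pm_def)
  also have "\<dots> * expectation (\<lambda>w. exp (rademacher c K u w)) \<le> exp ((u k)\<^sup>2 / 2) * exp ((\<Sum>k\<in>K. (u k)\<^sup>2) / 2)"
    using exp_plus_exp_minus_le[of "u k"] insert.IH by (intro mult_mono) auto
  also have "\<dots> = exp ((\<Sum>k\<in>insert k K. (u k)\<^sup>2) / 2)"
    using insert by (simp add: add_divide_distrib flip: exp_add)
  finally show ?case .
qed

lemma expectation_cosh_rademacher_le: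
  assumes "finite K" "(\<Sum>k\<in>K. (u k)\<^sup>2) = 1"
  shows "expectation (\<lambda>w. exp (rademacher c K u w) + exp (- rademacher c K u w)) \<le> 4"
proof -
  have int: "integrable M (\<lambda>w. exp (rademacher c K u w))" "integrable M (\<lambda>w. exp (- rademacher c K u w))"
    unfolding M_def
    by (rule integrable_isr[OF depends_on_compose[OF depends_on_rademacher] assms(1)])+
  have "expectation (\<lambda>w. exp (rademacher c K u w)) \<le> exp (1 / 2)"
    using expectation_exp_rademacher_le[OF assms(1), of u] assms(2) by simp
  moreover have "expectation (\<lambda>w. exp (- rademacher c K u w)) \<le> exp (1 / 2)"
    using expectation_exp_rademacher_le[OF assms(1), of "\<lambda>k. - u k"] assms(2)
    by (simp add: rademacher_def sum_negf)
  moreover have "exp (1 / 2 :: real) \<le> 2"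
    using exp_half_le2 by simp
  ultimately show ?thesis
    using int by simp
qed

text \<open>Powers are dominated by exponentials, whose moments are bounded for unit vectors. That
  \<open>K\<close> does not enter is what keeps the final cost independent of
  \<open>n\<close>.\<close>

lemma rademacher_moments_le:
  assumes "finite K" "(\<Sum>k\<in>K. (u k)\<^sup>2) = 1"
  shows "expectation (\<lambda>w. (rademacher c K u w)\<^sup>2) \<le> 4"
    and "expectation (\<lambda>w. (rademacher c K u w) ^ 4) \<le> 48"
proof -
  have int: "integrable M (\<lambda>w. g (rademacher c K u w))" for g :: "real \<Rightarrow> real"
    unfolding M_def by (rule integrable_isr[OF depends_on_compose[OF depends_on_rademacher] assms(1)])
  note cosh = expectation_cosh_rademacher_le[OF assms]
  have "expectation (\<lambda>w. (rademacher c K u w)\<^sup>2) \<le> expectation (\<lambda>w. exp (rademacher c K u w) + exp (- rademacher c K u w))"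
    by (intro integral_mono square_le_exp int[of "\<lambda>x. x\<^sup>2"] int[of "\<lambda>x. exp x + exp (- x)"])
  then show "expectation (\<lambda>w. (rademacher c K u w)\<^sup>2) \<le> 4"
    using cosh by linarith
  have "expectation (\<lambda>w. (rademacher c K u w) ^ 4)
      \<le> expectation (\<lambda>w. 12 * (exp (rademacher c K u w) + exp (- rademacher c K u w)))"
    by (intro integral_mono fourth_power_le_exp int[of "\<lambda>x. x ^ 4"] int[of "\<lambda>x. 12 * (exp x + exp (- x))"])
  also have "\<dots> = 12 * expectation (\<lambda>w. exp (rademacher c K u w) + exp (- rademacher c K u w))"
    by (rule integral_mult_right_zero)
  finally show "expectation (\<lambda>w. (rademacher c K u w) ^ 4) \<le> 48"
    using cosh by linarith
qed

end

text \<open>Only the diagonal survives, since distinct coins are independent and signs have mean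
  zero.\<close>

lemma expectation_rademacher_product:
  assumes \<rho>: "0 \<le> \<rho>" "\<rho> \<le> 1" and "finite K"
  shows "(\<integral>w. rademacher fst K u w * rademacher snd K v w \<partial>isr_space \<rho>) = \<rho> * (\<Sum>k\<in>K. u k * v k)"
proof -
  have E: "(\<integral>w. pm (fst (w k)) * pm (snd (w l)) \<partial>isr_space \<rho>) = (if k = l then \<rho> else 0)" for k l
  proof (cases "k = l")
    case True
    then show ?thesis
      using expectation_isr_correlation[OF \<rho>]
      by (simp add: expectation_coordinate[where g = "\<lambda>z. pm (fst z) * pm (snd z)"])
  next
    case False
    then have "(\<integral>w. pm (fst (w k)) * pm (snd (w l)) \<partial>isr_space \<rho>)
        = (\<integral>w. pm (fst (w k)) \<partial>isr_space \<rho>) * (\<integral>w. pm (snd (w l)) \<partial>isr_space \<rho>)"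
      by (intro expectation_mult_depends_on[where K = "{k}" and L = "{l}"]) (auto simp: depends_on_def)
    also have "(\<integral>w. pm (fst (w k)) \<partial>isr_space \<rho>) = 0"
      by (subst expectation_coordinate[where g = "\<lambda>z. pm (fst z)"]) (simp add: expectation_isr_fst[of \<rho> pm], simp add: pm_def)
    finally show ?thesis
      using False by simp
  qed
  have int: "integrable (isr_space \<rho>) (\<lambda>w. pm (fst (w k)) * pm (snd (w l)))" for k l
    by (rule integrable_isr[where K = "{k, l}"]) (auto simp: depends_on_def)
  have "rademacher fst K u w * rademacher snd K v w
      = (\<Sum>k\<in>K. \<Sum>l\<in>K. u k * v l * (pm (fst (w k)) * pm (snd (w l))))" for w
    by (simp add: rademacher_def sum_product mult_ac)
  then have "(\<integral>w. rademacher fst K u w * rademacher snd K v w \<partial>isr_space \<rho>)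
      = (\<Sum>k\<in>K. \<Sum>l\<in>K. u k * v l * (if k = l then \<rho> else 0))"
    by (simp add: int E)
  also have "\<dots> = (\<Sum>k\<in>K. u k * v k * \<rho>)"
    using \<open>finite K\<close> by (simp add: if_distrib cong: if_cong)
  finally show ?thesis
    by (simp add: sum_distrib_left mult_ac)
qed

text \<open>Rounding towards 0 never increases the absolute value, so second moments survive.\<close>

definition quantize :: "real \<Rightarrow> real \<Rightarrow> real \<Rightarrow> int" where
  "quantize L \<delta> a = (if \<bar>a\<bar> \<le> L then if a \<ge> 0 then \<lfloor>a / \<delta>\<rfloor> else - \<lfloor>- a / \<delta>\<rfloor> else 0)"

text \<open>In the second bound \<open>\<delta>\<close> is the rounding error within range, and
  \<open>a\<^sup>2 / L\<close> pays for values beyond \<open>L\<close>, which become 0. The third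
  bound limits the number of messages.\<close>

lemma quantize_bounds:
  assumes "\<delta> > 0" "L > 0"
  shows "\<bar>\<delta> * quantize L \<delta> a\<bar> \<le> \<bar>a\<bar>"
    and "\<bar>a - \<delta> * quantize L \<delta> a\<bar> \<le> \<delta> + a\<^sup>2 / L"
    and "\<bar>real_of_int (quantize L \<delta> a)\<bar> \<le> L / \<delta>"
proof -
  have pos: "0 \<le> \<delta> * \<lfloor>t / \<delta>\<rfloor>" "\<delta> * \<lfloor>t / \<delta>\<rfloor> \<le> t" "t \<le> \<delta> * \<lfloor>t / \<delta>\<rfloor> + \<delta>" if "t \<ge> 0" for t
  proof -
    have "real_of_int \<lfloor>t / \<delta>\<rfloor> \<le> t / \<delta>" "t / \<delta> \<le> real_of_int \<lfloor>t / \<delta>\<rfloor> + 1" "0 \<le> \<lfloor>t / \<delta>\<rfloor>"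
      using that assms by (auto intro: less_imp_le)
    from mult_left_mono[OF this(1), of \<delta>] mult_left_mono[OF this(2), of \<delta>] this(3)
    show "0 \<le> \<delta> * \<lfloor>t / \<delta>\<rfloor>" "\<delta> * \<lfloor>t / \<delta>\<rfloor> \<le> t" "t \<le> \<delta> * \<lfloor>t / \<delta>\<rfloor> + \<delta>"
      using assms by (simp_all add: distrib_left)
  qed
  show 1: "\<bar>\<delta> * quantize L \<delta> a\<bar> \<le> \<bar>a\<bar>"
    using pos[of "\<bar>a\<bar>"] by (auto simp: quantize_def abs_if split: if_splits)
  have sq: "a\<^sup>2 / L \<ge> 0"
    using assms by simp
  show "\<bar>a - \<delta> * quantize L \<delta> a\<bar> \<le> \<delta> + a\<^sup>2 / L"
  proof (cases "\<bar>a\<bar> \<le> L")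
    case True
    then have "\<bar>a - \<delta> * quantize L \<delta> a\<bar> \<le> \<delta>"
      using pos[of "\<bar>a\<bar>"] by (auto simp: quantize_def abs_if split: if_splits)
    then show ?thesis
      using sq by linarith
  next
    case False
    then have "\<bar>a\<bar> * L \<le> \<bar>a\<bar> * \<bar>a\<bar>"
      by (intro mult_left_mono) auto
    then have "\<bar>a\<bar> \<le> a\<^sup>2 / L"
      using assms by (simp add: pos_le_divide_eq power2_eq_square)
    then show ?thesis
      using False assms by (simp add: quantize_def)
  qed
  show "\<bar>real_of_int (quantize L \<delta> a)\<bar> \<le> L / \<delta>"
  proof (cases "\<bar>a\<bar> \<le> L")
    case True
    then have "\<delta> * \<bar>real_of_int (quantize L \<delta> a)\<bar> \<le> L"
      using 1 assms by (simp add: abs_mult)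
    then show ?thesis
      using assms by (simp add: field_simps)
  next
    case False
    then show ?thesis
      using assms by (simp add: quantize_def)
  qed
qed

text \<open>Rounding shrinks absolute values, so the square of the product is at most the mean of
  two fourth powers. The bias is split by AM-GM and the moments 4 and 48 are inserted:
  \<open>\<delta> / 2 + 2 * \<delta>\<close> and \<open>(4 + 48) / (2 * L)\<close>.\<close>

lemma quantized_product_moments:
  assumes \<rho>: "0 \<le> \<rho>" "\<rho> \<le> 1" and "finite K" and u: "(\<Sum>k\<in>K. (u k)\<^sup>2) = 1" and v: "(\<Sum>k\<in>K. (v k)\<^sup>2) = 1"
    and pos: "\<delta> > 0" "L > 0"
  defines "X \<equiv> \<lambda>w. \<delta> * quantize L \<delta> (rademacher fst K u w) * rademacher snd K v w"
  shows "(\<integral>w. (X w)\<^sup>2 \<partial>isr_space \<rho>) \<le> 48"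
    and "\<bar>(\<integral>w. X w \<partial>isr_space \<rho>) - \<rho> * (\<Sum>k\<in>K. u k * v k)\<bar> \<le> 5 / 2 * \<delta> + 26 / L"
proof -
  define A where "A = rademacher fst K u"
  define B where "B = rademacher snd K v"
  define A' where "A' w = \<delta> * quantize L \<delta> (A w)" for w
  have X: "X w = A' w * B w" for w
    by (simp add: X_def A'_def A_def B_def)
  have int: "integrable (isr_space \<rho>) (\<lambda>w. g (A w) (B w))" for g :: "real \<Rightarrow> real \<Rightarrow> real"
    unfolding A_def B_def using \<open>finite K\<close>
    by (intro integrable_isr[OF depends_on_compose2[OF depends_on_rademacher depends_on_rademacher]]) auto
  have moments: "(\<integral>w. (A w) ^ 4 \<partial>isr_space \<rho>) \<le> 48" "(\<integral>w. (B w)\<^sup>2 \<partial>isr_space \<rho>) \<le> 4"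
    "(\<integral>w. (B w) ^ 4 \<partial>isr_space \<rho>) \<le> 48"
    unfolding A_def B_def
    by (intro rademacher_moments_le expectation_isr_fst expectation_isr_snd \<open>finite K\<close> u v)+
  have "(\<integral>w. (X w)\<^sup>2 \<partial>isr_space \<rho>) \<le> (\<integral>w. 1 / 2 * (A w) ^ 4 + 1 / 2 * (B w) ^ 4 \<partial>isr_space \<rho>)"
  proof (rule integral_mono)
    show "integrable (isr_space \<rho>) (\<lambda>w. (X w)\<^sup>2)"
      unfolding X A'_def by (rule int[of "\<lambda>a b. (\<delta> * quantize L \<delta> a * b)\<^sup>2"])
    show "integrable (isr_space \<rho>) (\<lambda>w. 1 / 2 * (A w) ^ 4 + 1 / 2 * (B w) ^ 4)"
      by (rule int[of "\<lambda>a b. 1 / 2 * a ^ 4 + 1 / 2 * b ^ 4"])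
    fix w
    have "(A' w)\<^sup>2 \<le> (A w)\<^sup>2"
      using quantize_bounds(1)[OF pos, of "A w"] by (simp add: A'_def abs_le_square_iff)
    then have "(X w)\<^sup>2 \<le> (A w)\<^sup>2 * (B w)\<^sup>2"
      unfolding X power_mult_distrib by (intro mult_right_mono) auto
    also have "\<dots> \<le> 1 / 2 * (A w) ^ 4 + 1 / 2 * (B w) ^ 4"
      using sum_squares_bound[of "(A w)\<^sup>2" "(B w)\<^sup>2"] by simp
    finally show "(X w)\<^sup>2 \<le> 1 / 2 * (A w) ^ 4 + 1 / 2 * (B w) ^ 4" .
  qed
  also have "\<dots> = 1 / 2 * (\<integral>w. (A w) ^ 4 \<partial>isr_space \<rho>) + 1 / 2 * (\<integral>w. (B w) ^ 4 \<partial>isr_space \<rho>)"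
    using int[of "\<lambda>a b. a ^ 4"] int[of "\<lambda>a b. b ^ 4"] by simp
  finally show "(\<integral>w. (X w)\<^sup>2 \<partial>isr_space \<rho>) \<le> 48"
    using moments by linarith
  have iX: "integrable (isr_space \<rho>) X"
    using int[of "\<lambda>a b. \<delta> * quantize L \<delta> a * b"] by (simp add: X_def A_def B_def)
  have "\<bar>(\<integral>w. X w \<partial>isr_space \<rho>) - \<rho> * (\<Sum>k\<in>K. u k * v k)\<bar>
      = \<bar>(\<integral>w. X w - A w * B w \<partial>isr_space \<rho>)\<bar>"
    using expectation_rademacher_product[OF \<rho> \<open>finite K\<close>, of u v] iX int[of "\<lambda>a b. a * b"]
    by (simp add: A_def B_def)
  also have "\<dots> \<le> (\<integral>w. \<bar>X w - A w * B w\<bar> \<partial>isr_space \<rho>)"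
    by (rule integral_abs_bound)
  also have "\<dots> \<le> (\<integral>w. \<delta> / 2 + (\<delta> / 2 + 1 / (2 * L)) * (B w)\<^sup>2 + 1 / (2 * L) * (A w) ^ 4 \<partial>isr_space \<rho>)"
  proof (rule integral_mono)
    show "integrable (isr_space \<rho>) (\<lambda>w. \<bar>X w - A w * B w\<bar>)"
      using int[of "\<lambda>a b. \<bar>\<delta> * quantize L \<delta> a * b - a * b\<bar>"] by (simp add: X A'_def)
    show "integrable (isr_space \<rho>) (\<lambda>w. \<delta> / 2 + (\<delta> / 2 + 1 / (2 * L)) * (B w)\<^sup>2 + 1 / (2 * L) * (A w) ^ 4)"
      by (rule int[of "\<lambda>a b. \<delta> / 2 + (\<delta> / 2 + 1 / (2 * L)) * b\<^sup>2 + 1 / (2 * L) * a ^ 4"])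
    fix w
    have "\<bar>X w - A w * B w\<bar> = \<bar>A w - A' w\<bar> * \<bar>B w\<bar>"
      unfolding X abs_mult[symmetric] by (simp add: algebra_simps abs_minus_commute)
    also have "\<dots> \<le> (\<delta> + (A w)\<^sup>2 / L) * \<bar>B w\<bar>"
      unfolding A'_def by (intro mult_right_mono quantize_bounds(2) pos) auto
    also have "\<dots> = \<delta> * \<bar>B w\<bar> + 1 / L * ((A w)\<^sup>2 * \<bar>B w\<bar>)"
      by (simp add: algebra_simps)
    also have "\<dots> \<le> \<delta> * ((1 + (B w)\<^sup>2) / 2) + 1 / L * (((A w) ^ 4 + (B w)\<^sup>2) / 2)"
      using sum_squares_bound[of 1 "\<bar>B w\<bar>"] sum_squares_bound[of "(A w)\<^sup>2" "\<bar>B w\<bar>"] pos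
      by (intro add_mono mult_left_mono) auto
    also have "\<dots> = \<delta> / 2 + (\<delta> / 2 + 1 / (2 * L)) * (B w)\<^sup>2 + 1 / (2 * L) * (A w) ^ 4"
      using pos by (simp add: field_simps)
    finally show "\<bar>X w - A w * B w\<bar> \<le> \<dots>" .
  qed
  also have "\<dots> = \<delta> / 2 + (\<delta> / 2 + 1 / (2 * L)) * (\<integral>w. (B w)\<^sup>2 \<partial>isr_space \<rho>)
      + 1 / (2 * L) * (\<integral>w. (A w) ^ 4 \<partial>isr_space \<rho>)"
  proof -
    have "measure (isr_space \<rho>) (space (isr_space \<rho>)) = 1"
      by (intro prob_space.prob_space prob_space_PiM measure_pmf.prob_space_axioms)
    then show ?thesis
      using int[of "\<lambda>a b. a ^ 4"] int[of "\<lambda>a b. b\<^sup>2"] int[of "\<lambda>a b. \<delta> / 2"] by simp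
  qed
  also have "\<dots> \<le> \<delta> / 2 + (\<delta> / 2 + 1 / (2 * L)) * 4 + 1 / (2 * L) * 48"
    using moments pos by (intro add_mono mult_left_mono) auto
  also have "\<dots> = 5 / 2 * \<delta> + 26 / L"
    by (simp add: field_simps)
  finally show "\<bar>(\<integral>w. X w \<partial>isr_space \<rho>) - \<rho> * (\<Sum>k\<in>K. u k * v k)\<bar> \<le> 5 / 2 * \<delta> + 26 / L" .
qed

section \<open>Sketching the Hamming distance\<close>

definition chi :: "nat set \<Rightarrow> bool list \<Rightarrow> real" where
  "chi S x = (\<Prod>i\<in>S. if x ! i then -1 else 1)"

definition weight :: "nat \<Rightarrow> real \<Rightarrow> nat set \<Rightarrow> real" where
  "weight n p S = p ^ card S * (1 - p) ^ (n - card S)"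

text \<open>The product of two characters is a product of signs that are -1 exactly where
  \<open>x\<close> and \<open>y\<close> differ. Summing over \<open>S\<close> expands a product with
  factor \<open>1 - 2 * p\<close> at these coordinates and 1 elsewhere.\<close>

lemma sum_weight_chi:
  assumes "length x = n" "length y = n"
  shows "(\<Sum>S\<in>Pow {..<n}. weight n p S * (chi S x * chi S y)) = (1 - 2 * p) ^ hamming x y"
proof -
  define \<epsilon> :: "nat \<Rightarrow> real" where "\<epsilon> i = (if x ! i \<noteq> y ! i then -1 else 1)" for i
  have "(\<Sum>S\<in>Pow {..<n}. weight n p S * (chi S x * chi S y))
      = (\<Sum>S\<in>Pow {..<n}. (\<Prod>i\<in>S. p * \<epsilon> i) * (\<Prod>i\<in>{..<n} - S. 1 - p))"
  proof (rule sum.cong[OF refl])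
    fix S assume "S \<in> Pow {..<n}"
    then have "card ({..<n} - S) = n - card S"
      by (subst card_Diff_subset) (auto intro: finite_subset)
    moreover have "chi S x * chi S y = (\<Prod>i\<in>S. \<epsilon> i)"
      unfolding chi_def prod.distrib[symmetric] by (intro prod.cong) (auto simp: \<epsilon>_def)
    ultimately show "weight n p S * (chi S x * chi S y) = (\<Prod>i\<in>S. p * \<epsilon> i) * (\<Prod>i\<in>{..<n} - S. 1 - p)"
      by (simp add: weight_def prod.distrib)
  qed
  also have "\<dots> = (\<Prod>i<n. p * \<epsilon> i + (1 - p))"
    by (rule prod_add[symmetric]) simp
  also have "\<dots> = (\<Prod>i<n. if x ! i \<noteq> y ! i then 1 - 2 * p else 1)"
    by (intro prod.cong) (auto simp: \<epsilon>_def)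
  also have "\<dots> = (\<Prod>i\<in>{i. i < n \<and> x ! i \<noteq> y ! i}. 1 - 2 * p)"
    by (subst prod.inter_filter[symmetric]) (auto intro: prod.cong)
  also have "\<dots> = (1 - 2 * p) ^ hamming x y"
    using assms by (simp add: hamming_def)
  finally show ?thesis .
qed

text \<open>Sample \<open>j\<close> uses its own coins, one for each set of coordinates.\<close>

definition block :: "nat \<Rightarrow> nat \<Rightarrow> nat set" where
  "block n j = (\<lambda>S. prod_encode (j, set_encode S)) ` Pow {..<n}"

text \<open>The coin index is decoded into the set it stands for. Each player takes the square root
  of the weight, so that weights appear in inner products and all coefficient vectors have norm 1 on
  a block.\<close>

definition coef :: "nat \<Rightarrow> real \<Rightarrow> bool list \<Rightarrow> nat \<Rightarrow> real" where
  "coef n p x k = (let S = set_decode (snd (prod_decode k)) in sqrt (weight n p S) * chi S x)"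

lemma finite_block: "finite (block n j)"
  by (simp add: block_def)

lemma disjoint_blocks: "j \<noteq> l \<Longrightarrow> block n j \<inter> block n l = {}"
  by (auto simp: block_def)

lemma sum_coef_mult_coef:
  assumes "length x = n" "length y = n" "0 \<le> p" "p \<le> 1"
  shows "(\<Sum>k\<in>block n j. coef n p x k * coef n p y k) = (1 - 2 * p) ^ hamming x y"
proof -
  have fin: "finite S" if "S \<in> Pow {..<n}" for S
    using that finite_subset by auto
  have inj: "inj_on (\<lambda>S. prod_encode (j, set_encode S)) (Pow {..<n})"
    by (intro inj_onI) (metis Pair_inject fin prod_encode_inverse set_encode_inverse)
  have "(\<Sum>k\<in>block n j. coef n p x k * coef n p y k)
      = (\<Sum>S\<in>Pow {..<n}. weight n p S * (chi S x * chi S y))"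
    unfolding block_def sum.reindex[OF inj]
  proof (intro sum.cong refl)
    fix S assume S: "S \<in> Pow {..<n}"
    have "weight n p S \<ge> 0"
      using assms by (simp add: weight_def)
    then have "sqrt (weight n p S) * sqrt (weight n p S) = weight n p S"
      by simp
    then show "((\<lambda>k. coef n p x k * coef n p y k) \<circ> (\<lambda>S. prod_encode (j, set_encode S))) S
        = weight n p S * (chi S x * chi S y)"
      using fin[OF S] by (simp add: coef_def mult_ac)
  qed
  then show ?thesis
    using sum_weight_chi[OF assms(1,2)] by simp
qed

section \<open>Estimating the truncated distance\<close>

text \<open>The value \<open>Suc r\<close> stands for all distances beyond \<open>r\<close>. Error
  1/6 allows one message to be decoded against two strings with total error 1/3.\<close>

definition is_sketch :: "real \<Rightarrow> nat \<Rightarrow> nat \<Rightarrow> nat \<Rightarrow> 'm set \<Rightarrow> (bool list \<Rightarrow> coins \<Rightarrow> 'm) \<Rightarrow>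
    ('m \<Rightarrow> bool list \<Rightarrow> coins \<Rightarrow> nat) \<Rightarrow> bool" where
  "is_sketch \<rho> n r c Msg enc dec \<longleftrightarrow> finite Msg \<and> card Msg \<le> 2 ^ c \<and> (\<forall>x u. enc x u \<in> Msg) \<and>
    (\<forall>x. \<exists>K. finite K \<and> depends_on (enc x) K) \<and> (\<forall>m y. \<exists>K. finite K \<and> depends_on (dec m y) K) \<and>
    (\<forall>x y. length x = n \<and> length y = n \<longrightarrow> measure (isr_space \<rho>)
      {w. dec (enc x (\<lambda>i. fst (w i))) y (\<lambda>i. snd (w i)) \<noteq> min (hamming x y) (Suc r)} \<le> 1 / 6)"

text \<open>An estimate within half a gap of \<open>q D\<close> lies on the correct side of every
  midpoint with \<open>d \<le> r\<close>, so the midpoints above it are those with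
  \<open>d < D\<close>.\<close>

lemma count_midpoints_above:
  fixes q :: "nat \<Rightarrow> real"
  assumes q: "\<And>d. q (Suc d) \<le> q d" and gap: "\<And>d. d \<le> r \<Longrightarrow> g \<le> q d - q (Suc d)"
    and Y: "\<bar>Y - q D\<bar> < g / 2"
  shows "card {d. d \<le> r \<and> Y < (q d + q (Suc d)) / 2} = min D (Suc r)"
proof -
  have mono: "q l \<le> q d" if "d \<le> l" for d l
    using lift_Suc_antimono_le[of q, OF q that] .
  have "Y < (q d + q (Suc d)) / 2 \<longleftrightarrow> d < D" if "d \<le> r" for d
  proof (cases "d < D")
    case True
    then show ?thesis
      using mono[of "Suc d" D] gap[OF that] Y by (simp add: abs_if field_simps split: if_splits)
  next
    case False
    then show ?thesis
      using mono[of D d] gap[OF that] Y by (simp add: abs_if field_simps split: if_splits)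
  qed
  then have "{d. d \<le> r \<and> Y < (q d + q (Suc d)) / 2} = {..<min D (Suc r)}"
    by (auto simp: less_Suc_eq_le)
  then show ?thesis
    by simp
qed

lemma hamming_sketch_exists:
  fixes \<rho> :: real and n r :: nat
  assumes \<rho>: "0 < \<rho>" "\<rho> \<le> 1"
  defines "\<kappa> \<equiv> \<rho> / (8 * (real r + 1))"
  defines "T \<equiv> nat \<lceil>1152 / \<kappa>\<^sup>2\<rceil>"
  assumes b: "2 * (1040 / \<kappa>\<^sup>2) + 1 \<le> 2 ^ b"
  shows "\<exists>(Msg :: int list set) enc dec. is_sketch \<rho> n r (b * T) Msg enc dec"
proof -
  \<comment> \<open>\<open>p\<close> makes values at consecutive distances up to
    \<open>r + 1\<close> differ by at least \<open>2 * \<kappa>\<close>. \<open>L\<close> and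
    \<open>\<delta>\<close> make the errors \<open>26 / L\<close> and
    \<open>5 / 2 * \<delta>\<close> equal to \<open>\<kappa> / 4\<close> each;
    \<open>L / \<delta>\<close> bounds the transmitted integers.\<close>
  define p where "p = 1 / (4 * (real r + 1))"
  define L where "L = 104 / \<kappa>"
  define \<delta> where "\<delta> = \<kappa> / 10"
  define B where "B = \<lfloor>L / \<delta>\<rfloor>"
  define q where "q d = \<rho> * (1 - 2 * p) ^ d" for d :: nat
  have \<kappa>: "\<kappa> > 0"
    using \<rho> by (simp add: \<kappa>_def)
  have pos: "\<delta> > 0" "L > 0"
    using \<kappa> by (auto simp: \<delta>_def L_def)
  have p: "0 \<le> p" "p \<le> 1" "2 * p \<le> 1"
    by (auto simp: p_def field_simps)
  have T: "1152 / \<kappa>\<^sup>2 \<le> real T"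
    by (simp add: T_def real_nat_ceiling_ge)
  have T0: "T > 0"
    using T \<kappa> by (intro Nat.gr0I) (auto simp: field_simps)
  have LB: "L / \<delta> = 1040 / \<kappa>\<^sup>2"
    using \<kappa> by (simp add: L_def \<delta>_def power2_eq_square field_simps)
  define lin where "lin x j u = (\<Sum>k\<in>block n j. coef n p x k * pm (u k))" for x j and u :: coins
  define enc where "enc x u = map (\<lambda>j. quantize L \<delta> (lin x j u)) [0..<T]" for x u
  define est where "est m y u = (\<Sum>j<T. \<delta> * real_of_int (m ! j) * lin y j u) / T" for m :: "int list" and y u
  define dec where "dec m y u = card {d. d \<le> r \<and> est m y u < (q d + q (Suc d)) / 2}" for m y u
  define Msg where "Msg = {m. set m \<subseteq> {-B..B} \<and> length m = T}"
  have lin_eq: "lin x j u = lin x j u'" if "\<forall>k\<in>(\<Union>j<T. block n j). u k = u' k" "j < T" for x j u u'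
    using that by (auto simp: lin_def intro!: sum.cong)
  have B: "B \<ge> 0"
    using pos by (simp add: B_def)
  have "finite Msg"
    unfolding Msg_def by (rule finite_lists_length_eq) simp
  moreover have "card Msg \<le> 2 ^ (b * T)"
  proof -
    have "real_of_int B \<le> 1040 / \<kappa>\<^sup>2"
      unfolding LB[symmetric] B_def by (rule of_int_floor_le)
    then have "real_of_int (2 * B + 1) \<le> real_of_int (2 ^ b)"
      using b by simp
    then have "nat (2 * B + 1) \<le> 2 ^ b"
      unfolding of_int_le_iff by (simp add: nat_le_iff)
    then show ?thesis
      using B by (simp add: Msg_def card_lists_length_eq power_mult power_mono)
  qed
  moreover have "enc x u \<in> Msg" for x u
  proof -
    have "\<bar>quantize L \<delta> a\<bar> \<le> B" for a
      using quantize_bounds(3)[OF pos, of a] by (simp add: B_def le_floor_iff)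
    then have "- B \<le> quantize L \<delta> a \<and> quantize L \<delta> a \<le> B" for a
      by (metis abs_le_D1 abs_le_D2 minus_le_iff)
    then show ?thesis
      by (auto simp: Msg_def enc_def)
  qed
  moreover have "\<exists>K. finite K \<and> depends_on (enc x) K" for x
  proof (intro exI[of _ "\<Union>j<T. block n j"] conjI)
    show "depends_on (enc x) (\<Union>j<T. block n j)"
      unfolding depends_on_def enc_def
      by (intro allI impI map_cong refl arg_cong[where f = "quantize L \<delta>"] lin_eq) auto
  qed (simp add: finite_block)
  moreover have "\<exists>K. finite K \<and> depends_on (dec m y) K" for m y
  proof (intro exI[of _ "\<Union>j<T. block n j"] conjI)
    have "depends_on (est m y) (\<Union>j<T. block n j)"
      unfolding depends_on_def est_def
      by (intro allI impI arg_cong2[where f = "(/)"] arg_cong2[where f = "(*)"] sum.cong refl lin_eq) auto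
    then show "depends_on (dec m y) (\<Union>j<T. block n j)"
      unfolding dec_def by (rule depends_on_compose[where f = "est m y"])
  qed (simp add: finite_block)
  moreover have "measure (isr_space \<rho>)
      {w. dec (enc x (\<lambda>i. fst (w i))) y (\<lambda>i. snd (w i)) \<noteq> min (hamming x y) (Suc r)} \<le> 1 / 6"
    if xy: "length x = n" "length y = n" for x y
  proof -
    define X where "X j w = \<delta> * quantize L \<delta> (rademacher fst (block n j) (coef n p x) w)
        * rademacher snd (block n j) (coef n p y) w" for j w
    define E where "E j = (\<integral>w. X j w \<partial>isr_space \<rho>)" for j
    have sq: "(\<Sum>k\<in>block n j. (coef n p z k)\<^sup>2) = 1" if "length z = n" for z j
      using sum_coef_mult_coef[OF that that p(1,2), of j] by (simp add: hamming_def power2_eq_square)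
    have second: "(\<integral>w. (X j w)\<^sup>2 \<partial>isr_space \<rho>) \<le> 48" for j
      unfolding X_def using \<rho> finite_block sq xy pos by (intro quantized_product_moments) auto
    have mean: "\<bar>E j - q (hamming x y)\<bar> \<le> \<kappa> / 2" for j
    proof -
      have "\<bar>E j - q (hamming x y)\<bar> \<le> 5 / 2 * \<delta> + 26 / L"
        unfolding E_def X_def q_def sum_coef_mult_coef[OF xy p(1,2), of j, symmetric]
        using \<rho> finite_block sq xy pos by (intro quantized_product_moments) auto
      also have "\<dots> = \<kappa> / 2"
        using \<kappa> by (simp add: \<delta>_def L_def)
      finally show ?thesis .
    qed
    have depX: "depends_on (X j) (block n j)" for j
      unfolding X_def
      using depends_on_compose2[OF depends_on_rademacher[of fst "block n j"] depends_on_rademacher[of snd "block n j"],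
          where h = "\<lambda>a b. \<delta> * quantize L \<delta> a * b"]
      by simp
    have "measure (isr_space \<rho>) {w \<in> space (isr_space \<rho>). \<bar>\<Sum>j<T. X j w - E j\<bar> \<ge> T * \<kappa> / 2}
        \<le> real T * 48 / (T * \<kappa> / 2)\<^sup>2"
      unfolding E_def using depX finite_block disjoint_blocks second T0 \<kappa>
      by (intro prob_sum_deviation_le[where K = "block n"]) auto
    \<comment> \<open>The left side is \<open>192 / (T * \<kappa>\<^sup>2)\<close>; this explains
      the 1152 in \<open>T\<close>.\<close>
    also have "\<dots> \<le> 1 / 6"
      using T T0 \<kappa> by (simp add: power2_eq_square field_simps)
    finally have dev: "measure (isr_space \<rho>) {w \<in> space (isr_space \<rho>). \<bar>\<Sum>j<T. X j w - E j\<bar> \<ge> T * \<kappa> / 2} \<le> 1 / 6" .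
    have correct: "dec (enc x (\<lambda>i. fst (w i))) y (\<lambda>i. snd (w i)) = min (hamming x y) (Suc r)"
      if w: "\<bar>\<Sum>j<T. X j w - E j\<bar> < T * \<kappa> / 2" for w
      unfolding dec_def
    proof (rule count_midpoints_above[where g = "2 * \<kappa>"])
      define Y where "Y = est (enc x (\<lambda>i. fst (w i))) y (\<lambda>i. snd (w i))"
      have "T * Y = (\<Sum>j<T. X j w)"
        using T0 by (simp add: Y_def est_def enc_def X_def lin_def rademacher_def)
      then have "T * \<bar>Y - q (hamming x y)\<bar> = \<bar>(\<Sum>j<T. X j w - E j) + (\<Sum>j<T. E j - q (hamming x y))\<bar>"
        by (simp add: sum_subtractf abs_mult[of "real T", simplified, symmetric] right_diff_distrib)
      also have "\<dots> \<le> \<bar>\<Sum>j<T. X j w - E j\<bar> + (\<Sum>j<T. \<bar>E j - q (hamming x y)\<bar>)"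
        by (rule order_trans[OF abs_triangle_ineq add_left_mono[OF sum_abs]])
      \<comment> \<open>Half of the permitted error \<open>\<kappa>\<close> is random deviation, the
        other half is bias from rounding.\<close>
      also have "\<dots> < T * \<kappa> / 2 + (\<Sum>j<T. \<kappa> / 2)"
        using w mean by (intro add_less_le_mono sum_mono) auto
      also have "\<dots> = T * \<kappa>"
        by simp
      finally show "\<bar>est (enc x (\<lambda>i. fst (w i))) y (\<lambda>i. snd (w i)) - q (hamming x y)\<bar> < 2 * \<kappa> / 2"
        using T0 by (simp add: Y_def)
    next
      fix d
      have "(1 - 2 * p) ^ d * (1 - 2 * p) \<le> (1 - 2 * p) ^ d * 1"
        using p by (intro mult_left_mono) auto
      then show "q (Suc d) \<le> q d"
        using \<rho> by (simp add: q_def mult_ac)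
    next
      fix d assume d: "d \<le> r"
      \<comment> \<open>For \<open>d \<le> r\<close> the choice of \<open>p\<close> gives
        \<open>2 * p * d \<le> 1 / 2\<close>, so Bernoulli's inequality keeps the power at least
        1/2.\<close>
      have "1 / 2 \<le> 1 + real d * (- (2 * p))"
        using d by (simp add: p_def field_simps)
      also have "\<dots> \<le> (1 + - (2 * p)) ^ d"
        using p by (intro Bernoulli_inequality) auto
      finally have "\<rho> * (2 * p) * (1 / 2) \<le> \<rho> * (2 * p) * (1 - 2 * p) ^ d"
        using \<rho> p by (intro mult_left_mono) auto
      also have "\<dots> = q d - q (Suc d)"
        by (simp add: q_def algebra_simps)
      finally show "2 * \<kappa> \<le> q d - q (Suc d)"
        by (simp add: \<kappa>_def p_def field_simps)
    qed
    have "{w. dec (enc x (\<lambda>i. fst (w i))) y (\<lambda>i. snd (w i)) \<noteq> min (hamming x y) (Suc r)}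
        \<subseteq> {w \<in> space (isr_space \<rho>). \<bar>\<Sum>j<T. X j w - E j\<bar> \<ge> T * \<kappa> / 2}"
      by (rule subsetI, rule CollectI, rule conjI, simp add: space_PiM, rule ccontr)
         (use correct in \<open>simp add: not_le\<close>)
    moreover have "{w \<in> space (isr_space \<rho>). \<bar>\<Sum>j<T. X j w - E j\<bar> \<ge> T * \<kappa> / 2} \<in> sets (isr_space \<rho>)"
    proof -
      have "X j \<in> borel_measurable (isr_space \<rho>)" for j
        by (rule measurable_depends_on[OF depX finite_block]) auto
      then show ?thesis
        by measurable
    qed
    ultimately have "measure (isr_space \<rho>)
        {w. dec (enc x (\<lambda>i. fst (w i))) y (\<lambda>i. snd (w i)) \<noteq> min (hamming x y) (Suc r)}
        \<le> measure (isr_space \<rho>) {w \<in> space (isr_space \<rho>). \<bar>\<Sum>j<T. X j w - E j\<bar> \<ge> T * \<kappa> / 2}"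
      by (intro finite_measure.finite_measure_mono prob_space.finite_measure prob_space_PiM
            measure_pmf.prob_space_axioms)
    then show ?thesis
      using dev by linarith
  qed
  ultimately have "is_sketch \<rho> n r (b * T) Msg enc dec"
    unfolding is_sketch_def by blast
  then show ?thesis
    by blast
qed

section \<open>One-way protocols from sketches\<close>

text \<open>\<open>m\<close> collects the bits sent so far. Bob's last node announces the result,
  because the transcript of a tree must determine the output; this is the one extra bit.\<close>

primrec one_way_protocol ::
    "(bool list \<Rightarrow> coins \<Rightarrow> bool list) \<Rightarrow> (bool list \<Rightarrow> bool list \<Rightarrow> coins \<Rightarrow> bool) \<Rightarrow> nat \<Rightarrow> bool list \<Rightarrow> protocol" where
  "one_way_protocol enc dec 0 m = Bob (dec m) (Output True) (Output False)"
| "one_way_protocol enc dec (Suc k) m = Alice (\<lambda>x u. enc x u ! length m)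
     (one_way_protocol enc dec k (m @ [True])) (one_way_protocol enc dec k (m @ [False]))"

lemma cost_one_way_protocol: "cost (one_way_protocol enc dec k m) = Suc k"
  by (induction k arbitrary: m) auto

lemma run_one_way_protocol:
  "length (enc x u) = length m + k \<Longrightarrow> m = take (length m) (enc x u) \<Longrightarrow>
    run (one_way_protocol enc dec k m) x u y v = dec (enc x u) y v"
proof (induction k arbitrary: m)
  case (Suc k)
  have *: "m @ [enc x u ! length m] = take (length (m @ [enc x u ! length m])) (enc x u)"
    using Suc.prems by (simp add: take_Suc_conv_app_nth)
  show ?case
    using Suc.IH[of "m @ [enc x u ! length m]"] Suc.prems(1) * by (cases "enc x u ! length m") auto
qed auto

lemma measurable_one_way_protocol:
  assumes "\<And>x. enc x \<in> coin_space \<rightarrow>\<^sub>M count_space UNIV" "\<And>m y. dec m y \<in> coin_space \<rightarrow>\<^sub>M count_space UNIV"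
  shows "measurable_protocol (one_way_protocol enc dec k m)"
  using assms by (induction k arbitrary: m) (auto intro: measurable_compose)

lemma two_way_cc_le_one_way:
  assumes "one_way_computes M n f c enc dec"
  shows "two_way_cc M n f \<le> Suc c"
proof -
  have "computes M n f (one_way_protocol enc dec c [])"
    using assms run_one_way_protocol[where m = "[]" and k = c] measurable_one_way_protocol
    by (auto simp: computes_def one_way_computes_def)
  then show ?thesis
    unfolding two_way_cc_def using cost_one_way_protocol by (intro Least_le) blast
qed

lemma measurable_coins_depends_on:
  "depends_on g K \<Longrightarrow> finite K \<Longrightarrow> g \<in> coin_space \<rightarrow>\<^sub>M count_space UNIV"
  unfolding coin_space_def by (rule measurable_depends_on) auto

lemma prob_isr_coins:
  assumes "{w. Q (fst w) (snd w)} \<in> sets (coin_space \<Otimes>\<^sub>M coin_space)"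
  shows "\<P>(w in isr_coins \<rho>. Q (fst w) (snd w)) = measure (isr_space \<rho>) {w. Q (\<lambda>i. fst (w i)) (\<lambda>i. snd (w i))}"
proof -
  have space: "space (coin_space \<Otimes>\<^sub>M coin_space) = UNIV" "space (isr_space \<rho>) = UNIV"
    by (auto simp: space_pair_measure coin_space_def space_PiM)
  show ?thesis
    unfolding isr_coins_def using assms
    by (simp add: space measure_distr[OF measurable_isr] vimage_def)
qed

text \<open>The coins that Bob consults may vary with the message, but a finite set of messages
  makes their union finite.\<close>

lemma depends_on_exchange:
  fixes Msg :: "'m set" and enc :: "coins \<Rightarrow> 'm" and dec :: "'m \<Rightarrow> coins \<Rightarrow> 'b"
  assumes Msg: "finite Msg" and enc: "\<And>u. enc u \<in> Msg" "\<exists>K. finite K \<and> depends_on enc K"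
    and dec: "\<And>m. \<exists>K. finite K \<and> depends_on (dec m) K"
  shows "\<exists>K. finite K \<and> depends_on (\<lambda>w. dec (enc (\<lambda>i. fst (w i))) (\<lambda>i. snd (w i))) K"
proof -
  obtain K where K: "finite K" "depends_on enc K"
    using enc(2) by blast
  obtain L where L: "\<And>m. finite (L m)" "\<And>m. depends_on (dec m) (L m)"
    using dec by metis
  have "dec (enc (\<lambda>i. fst (w i))) (\<lambda>i. snd (w i)) = dec (enc (\<lambda>i. fst (w' i))) (\<lambda>i. snd (w' i))"
    if w: "\<forall>k\<in>K \<union> (\<Union>m\<in>Msg. L m). w k = w' k" for w w'
  proof -
    have 1: "enc (\<lambda>i. fst (w i)) = enc (\<lambda>i. fst (w' i))"
      by (rule depends_onD[OF K(2)]) (use w in auto)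
    have 2: "dec m (\<lambda>i. snd (w i)) = dec m (\<lambda>i. snd (w' i))" if "m \<in> Msg" for m
      by (rule depends_onD[OF L(2)[of m]], rule arg_cong[where f = snd]) (use w that in blast)
    show ?thesis
      unfolding 1 by (rule 2) (rule enc(1))
  qed
  then show ?thesis
    using K(1) L(1) Msg by (intro exI[of _ "K \<union> (\<Union>m\<in>Msg. L m)"]) (auto simp: depends_on_def)
qed

lemma sets_isr_depends_on:
  assumes "\<exists>K. finite K \<and> depends_on g K"
  shows "{w. g w \<in> A} \<in> sets (isr_space \<rho>)"
proof -
  have "g \<in> isr_space \<rho> \<rightarrow>\<^sub>M count_space UNIV"
    using assms by (auto intro: measurable_depends_on)
  then have "g -` A \<inter> space (isr_space \<rho>) \<in> sets (isr_space \<rho>)"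
    by (rule measurable_sets) simp
  then show ?thesis
    by (simp add: space_PiM vimage_def)
qed

text \<open>An injection \<open>\<iota>\<close> names messages by bit strings of length
  \<open>c\<close>, and Bob inverts it. The two-way bound adds the bit for Bob's answer.\<close>

lemma ISR_cc_le:
  fixes Msg :: "'m set"
  assumes Msg: "finite Msg" "card Msg \<le> 2 ^ c"
    and enc: "\<And>x u. enc x u \<in> Msg" "\<And>x. \<exists>K. finite K \<and> depends_on (enc x) K"
    and dec: "\<And>m y. \<exists>K. finite K \<and> depends_on (dec m y) K"
    and correct: "\<And>x y. length x = n \<Longrightarrow> length y = n \<Longrightarrow>
      measure (isr_space \<rho>) {w. dec (enc x (\<lambda>i. fst (w i))) y (\<lambda>i. snd (w i)) \<noteq> f x y} \<le> 1 / 3"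
  shows "ISR_cc \<rho> n f \<le> Suc c" "ISR_one_way_cc \<rho> n f \<le> c"
proof -
  have "card {l :: bool list. set l \<subseteq> UNIV \<and> length l = c} = 2 ^ c"
    by (subst card_lists_length_eq) auto
  then have "card Msg \<le> card {l :: bool list. length l = c}"
    using Msg by simp
  moreover have "finite {l :: bool list. length l = c}"
    using finite_lists_length_eq[of "UNIV :: bool set" c] by simp
  ultimately obtain \<iota> where \<iota>: "\<iota> ` Msg \<subseteq> {l :: bool list. length l = c}" "inj_on \<iota> Msg"
    using card_le_inj[OF Msg(1)] by blast
  define enc' where "enc' x u = \<iota> (enc x u)" for x u
  define dec' where "dec' l = dec (inv_into Msg \<iota> l)" for l
  have dec': "dec' (enc' x u) y v = dec (enc x u) y v" for x u y v
    using enc(1) \<iota> by (simp add: dec'_def enc'_def)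
  have "one_way_computes (isr_coins \<rho>) n f c enc' dec'"
    unfolding one_way_computes_def
  proof (intro conjI allI impI)
    show "length (enc' x u) = c" for x u
      using enc(1) \<iota> by (auto simp: enc'_def)
    show menc: "enc' x \<in> coin_space \<rightarrow>\<^sub>M count_space UNIV" for x
      using enc(2)[of x] unfolding enc'_def by (blast intro: measurable_coins_depends_on depends_on_compose)
    show mdec: "dec' m y \<in> coin_space \<rightarrow>\<^sub>M count_space UNIV" for m y
      using dec unfolding dec'_def by (blast intro: measurable_coins_depends_on)
    fix x y :: "bool list" assume xy: "length x = n \<and> length y = n"
    have "(\<lambda>w. dec' (enc' x (fst w)) y (snd w)) \<in> coin_space \<Otimes>\<^sub>M coin_space \<rightarrow>\<^sub>M count_space UNIV"
      by (rule measurable_compose_countable[OF measurable_compose[OF measurable_snd mdec]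
            measurable_compose[OF measurable_fst menc]])
    then have "{w \<in> space (coin_space \<Otimes>\<^sub>M coin_space). dec' (enc' x (fst w)) y (snd w) = f x y}
        \<in> sets (coin_space \<Otimes>\<^sub>M coin_space)"
      by measurable
    then have sets: "{w. dec' (enc' x (fst w)) y (snd w) = f x y} \<in> sets (coin_space \<Otimes>\<^sub>M coin_space)"
      by (simp add: space_pair_measure coin_space_def space_PiM)
    define Bad where "Bad = {w. dec (enc x (\<lambda>i. fst (w i))) y (\<lambda>i. snd (w i)) \<noteq> f x y}"
    have "Bad \<in> sets (isr_space \<rho>)"
      unfolding Bad_def
      using sets_isr_depends_on[OF depends_on_exchange[where enc = "enc x" and dec = "\<lambda>m. dec m y", OF Msg(1) enc(1,2) dec], where A = "- {f x y}" and \<rho> = \<rho>]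
      by simp
    then have "measure (isr_space \<rho>) (space (isr_space \<rho>) - Bad) = 1 - measure (isr_space \<rho>) Bad"
      by (intro prob_space.prob_compl prob_space_PiM measure_pmf.prob_space_axioms)
    moreover have "space (isr_space \<rho>) - Bad = {w. dec (enc x (\<lambda>i. fst (w i))) y (\<lambda>i. snd (w i)) = f x y}"
      by (auto simp: Bad_def space_PiM)
    moreover have "measure (isr_space \<rho>) Bad \<le> 1 / 3"
      unfolding Bad_def using correct xy by blast
    ultimately show "\<P>(w in isr_coins \<rho>. dec' (enc' x (fst w)) y (snd w) = f x y) \<ge> 2 / 3"
      using prob_isr_coins[OF sets, of \<rho>] by (simp add: dec')
  qed
  then show "ISR_cc \<rho> n f \<le> Suc c" "ISR_one_way_cc \<rho> n f \<le> c"
    unfolding ISR_cc_def ISR_one_way_cc_def one_way_cc_def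
    by (auto intro: two_way_cc_le_one_way Least_le)
qed

section \<open>Optimal protocols and the case of zero cost\<close>

lemma R_cc_attained: "\<exists>P. computes public_coins n f P \<and> cost P = R_cc n f"
  unfolding R_cc_def two_way_cc_def
  using computes_exists[OF prob_space_public_coins, of n f]
    LeastI_ex[of "\<lambda>c. \<exists>P. computes public_coins n f P \<and> cost P = c"] by blast

text \<open>A tree of cost 0 is a single leaf, and a fixed output is correct with positive
  probability only if it is correct. The case matters because the final bounds vanish at
  \<open>k = 0\<close>.\<close>

lemma constant_if_R_cc_eq_0:
  assumes "R_cc n f = 0"
  obtains b where "\<And>x y. length x = n \<Longrightarrow> length y = n \<Longrightarrow> f x y = b"
proof -
  obtain P where P: "computes public_coins n f P" "cost P = 0"
    using R_cc_attained[of n f] assms by auto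
  then obtain b where b: "P = Output b"
    by (cases P) auto
  have "f x y = b" if "length x = n" "length y = n" for x y
  proof (rule ccontr)
    assume "f x y \<noteq> b"
    moreover have "\<P>(w in public_coins. b = f x y) \<ge> 2 / 3"
      using P(1) that by (auto simp: b computes_def)
    ultimately show False
      by auto
  qed
  then show thesis
    by (rule that)
qed

lemma ISR_cc_constant:
  assumes "\<And>x y. length x = n \<Longrightarrow> length y = n \<Longrightarrow> f x y = b"
  shows "ISR_cc \<rho> n f = 0" "ISR_one_way_cc \<rho> n f = 0"
proof -
  have "computes (isr_coins \<rho>) n f (Output b)"
    using assms prob_space.prob_space[OF prob_space_isr_coins[of \<rho>]] by (auto simp: computes_def)
  then have "ISR_cc \<rho> n f \<le> 0"
    unfolding ISR_cc_def two_way_cc_def by (intro Least_le) (auto intro!: exI[of _ "Output b"])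
  then show "ISR_cc \<rho> n f = 0"
    by simp
  have "one_way_computes (isr_coins \<rho>) n f 0 (\<lambda>_ _. []) (\<lambda>_ _ _. b)"
    using assms prob_space.prob_space[OF prob_space_isr_coins[of \<rho>]] by (auto simp: one_way_computes_def)
  then have "ISR_one_way_cc \<rho> n f \<le> 0"
    unfolding ISR_one_way_cc_def one_way_cc_def by (intro Least_le) blast
  then show "ISR_one_way_cc \<rho> n f = 0"
    by simp
qed

lemma sets_sketch_error:
  assumes "is_sketch \<rho> n r c Msg enc dec"
  shows "{w. dec (enc x (\<lambda>i. fst (w i))) y (\<lambda>i. snd (w i)) \<noteq> e} \<in> sets (isr_space \<rho>)"
proof -
  have "finite Msg" "\<And>u. enc x u \<in> Msg" "\<exists>K. finite K \<and> depends_on (enc x) K"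
    "\<And>m. \<exists>K. finite K \<and> depends_on (dec m y) K"
    using assms by (auto simp: is_sketch_def)
  from sets_isr_depends_on[OF depends_on_exchange[where enc = "enc x" and dec = "\<lambda>m. dec m y", OF this],
      where A = "- {e}" and \<rho> = \<rho>]
  show ?thesis
    by simp
qed

section \<open>From truncated distances to XOR and AND type functions\<close>

text \<open>Decoding the same message against the complement of Bob's string measures distances near
  \<open>n\<close> without further communication.\<close>

lemma hamming_map_Not:
  assumes "length x = n" "length y = n"
  shows "hamming x (map Not y) = n - hamming x y"
proof -
  have "{i. i < n \<and> x ! i \<noteq> map Not y ! i} = {i. i < n \<and> ((x ! i \<noteq> y ! i) \<noteq> True)}"
    using assms by auto
  then show ?thesis
    using card_less_neq[of n "\<lambda>i. x ! i \<noteq> y ! i" True] assms by (simp add: hamming_def)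
qed

definition ones :: "bool list \<Rightarrow> nat set" where
  "ones x = {i. i < length x \<and> x ! i}"

text \<open>The first identity gives the parity of the distance from the two weights; the second
  recovers the size of the union.\<close>

lemma hamming_eq_card_sym_diff:
  assumes "length x = length y"
  shows "hamming x y + 2 * card (ones x \<inter> ones y) = card (ones x) + card (ones y)"
    and "hamming x y + card (ones x) + card (ones y) = 2 * card (ones x \<union> ones y)"
proof -
  have fin: "finite (ones x)" "finite (ones y)"
    by (auto simp: ones_def)
  have "{i. i < length x \<and> x ! i \<noteq> y ! i} = (ones x - ones y) \<union> (ones y - ones x)"
    using assms by (auto simp: ones_def)
  then have "hamming x y = card (ones x - ones y) + card (ones y - ones x)"
    unfolding hamming_def using fin by (subst card_Un_disjoint[symmetric]) auto
  moreover have "card (ones x - ones y) + card (ones x \<inter> ones y) = card (ones x)"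
    "card (ones y - ones x) + card (ones x \<inter> ones y) = card (ones y)"
    using fin by (metis add.commute card_Int_Diff Int_commute)+
  moreover have "card (ones x) + card (ones y) = card (ones x \<union> ones y) + card (ones x \<inter> ones y)"
    using fin by (rule card_Un_Int)
  ultimately show "hamming x y + 2 * card (ones x \<inter> ones y) = card (ones x) + card (ones y)"
    and "hamming x y + card (ones x) + card (ones y) = 2 * card (ones x \<union> ones y)"
    by linarith+
qed

lemma hamming_le: "hamming x y \<le> length x"
  unfolding hamming_def using card_mono[of "{..<length x}" "{i. i < length x \<and> x ! i \<noteq> y ! i}"] by auto

lemma constant_on_parity_class:
  fixes G :: "nat \<Rightarrow> 'b"
  assumes step: "\<And>i. r < i \<Longrightarrow> i + 2 + r < n \<Longrightarrow> G i = G (i + 2)"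
    and "r < d" "d + 2 * k + r < n"
  shows "G d = G (d + 2 * k)"
  using assms(2,3)
proof (induction k)
  case (Suc k)
  then have "G (d + 2 * k) = G (d + 2 * k + 2)"
    by (intro step) auto
  then show ?case
    using Suc by simp
qed simp

text \<open>Agreement of both truncations forces \<open>d = e\<close> unless both lie in the
  interior, where equal parity lets steps of 2 connect them.\<close>

lemma constant_on_middle:
  fixes G :: "nat \<Rightarrow> 'b"
  assumes step: "\<And>i. r < i \<Longrightarrow> i + 2 + r < n \<Longrightarrow> G i = G (i + 2)"
    and d: "d \<le> n" "e \<le> n" "min d (Suc r) = min e (Suc r)" "min (n - d) (Suc r) = min (n - e) (Suc r)"
    and parity: "odd d = odd e"
  shows "G d = G e"
proof -
  have *: "G d = G e" if "d \<le> e" "r < d" "r < n - e" "odd d = odd e" for d e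
  proof -
    have "even (e - d)"
      using that by simp
    then obtain k where "e - d = 2 * k"
      by (elim evenE)
    then have "e = d + 2 * k"
      using that by simp
    then show ?thesis
      using that constant_on_parity_class[where G = G, OF step, of r n d k] by simp
  qed
  consider "d = e" | "r < d" "r < e" "r < n - d" "r < n - e"
    using d by (auto simp: min_def split: if_splits)
  then show ?thesis
  proof cases
    case 2
    show ?thesis
    proof (cases "d \<le> e")
      case True
      then show ?thesis
        using 2 parity by (intro *)
    next
      case False
      then have "G e = G d"
        using 2 parity by (intro *) simp_all
      then show ?thesis
        by (rule sym)
    qed
  qed simp
qed

text \<open>Alice adds the parity of her weight to the sketch. Bob decodes against \<open>y\<close>
  and its complement; each decoding fails with probability at most 1/6, and all distances compatible
  with the results share one value of \<open>G\<close>.\<close>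

lemma ISR_cc_XOR_le:
  assumes sk: "is_sketch \<rho> n r c Msg enc dec"
    and f: "\<And>x y. length x = n \<Longrightarrow> length y = n \<Longrightarrow> f x y = G (hamming x y)"
    and step: "\<And>i. r < i \<Longrightarrow> i + 2 + r < n \<Longrightarrow> G i = G (i + 2)"
  shows "ISR_cc \<rho> n f \<le> c + 2" "ISR_one_way_cc \<rho> n f \<le> c + 1"
proof -
  define enc' where "enc' x u = (enc x u, odd (card (ones x)))" for x u
  define guess where "guess par y e e' d \<longleftrightarrow> d \<le> n \<and> min d (Suc r) = e \<and> min (n - d) (Suc r) = e' \<and>
      odd d = (par \<noteq> odd (card (ones y)))" for par and y :: "bool list" and e e' d
  \<comment> \<open>Any compatible distance serves; the true one witnesses \<open>SOME\<close> when
    both decodings are right.\<close>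
  define dec' where "dec' mp y v =
      G (SOME d. guess (snd mp) y (dec (fst mp) y v) (dec (fst mp) (map Not y) v) d)" for mp y v
  have sk': "finite Msg" "card Msg \<le> 2 ^ c" "\<And>x u. enc x u \<in> Msg" "\<And>x. \<exists>K. finite K \<and> depends_on (enc x) K"
    "\<And>m y. \<exists>K. finite K \<and> depends_on (dec m y) K"
    "\<And>x y. length x = n \<Longrightarrow> length y = n \<Longrightarrow> measure (isr_space \<rho>)
      {w. dec (enc x (\<lambda>i. fst (w i))) y (\<lambda>i. snd (w i)) \<noteq> min (hamming x y) (Suc r)} \<le> 1 / 6"
    using sk by (auto simp: is_sketch_def)
  have good: "dec' (enc' x u) y v = f x y"
    if xy: "length x = n" "length y = n" and "dec (enc x u) y v = min (hamming x y) (Suc r)"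
      and "dec (enc x u) (map Not y) v = min (n - hamming x y) (Suc r)" for x y u v
  proof -
    have "odd (hamming x y) = (odd (card (ones x)) \<noteq> odd (card (ones y)))"
    proof -
      have "odd (hamming x y + 2 * card (ones x \<inter> ones y)) = odd (card (ones x) + card (ones y))"
        using hamming_eq_card_sym_diff(1)[of x y] xy by simp
      then show ?thesis
        by simp
    qed
    then have g: "guess (odd (card (ones x))) y (dec (enc x u) y v) (dec (enc x u) (map Not y) v) (hamming x y)"
      using that hamming_le[of x y] by (simp add: guess_def)
    define d where "d = (SOME d. guess (odd (card (ones x))) y (dec (enc x u) y v) (dec (enc x u) (map Not y) v) d)"
    have "guess (odd (card (ones x))) y (dec (enc x u) y v) (dec (enc x u) (map Not y) v) d"
      unfolding d_def using g by (rule someI)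
    with g have "G d = G (hamming x y)"
      by (intro constant_on_middle[where G = G, OF step]) (auto simp: guess_def)
    then show ?thesis
      using f[OF xy] by (simp add: dec'_def enc'_def d_def)
  qed
  have "measure (isr_space \<rho>) {w. dec' (enc' x (\<lambda>i. fst (w i))) y (\<lambda>i. snd (w i)) \<noteq> f x y} \<le> 1 / 3"
    if xy: "length x = n" "length y = n" for x y
  proof -
    define B1 where "B1 = {w. dec (enc x (\<lambda>i. fst (w i))) y (\<lambda>i. snd (w i)) \<noteq> min (hamming x y) (Suc r)}"
    define B2 where "B2 = {w. dec (enc x (\<lambda>i. fst (w i))) (map Not y) (\<lambda>i. snd (w i))
        \<noteq> min (hamming x (map Not y)) (Suc r)}"
    have sets: "B1 \<in> sets (isr_space \<rho>)" "B2 \<in> sets (isr_space \<rho>)"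
      unfolding B1_def B2_def by (intro sets_sketch_error[OF sk])+
    have "{w. dec' (enc' x (\<lambda>i. fst (w i))) y (\<lambda>i. snd (w i)) \<noteq> f x y} \<subseteq> B1 \<union> B2"
      using good[OF xy] by (auto simp: B1_def B2_def hamming_map_Not[OF xy])
    then have "measure (isr_space \<rho>) {w. dec' (enc' x (\<lambda>i. fst (w i))) y (\<lambda>i. snd (w i)) \<noteq> f x y}
        \<le> measure (isr_space \<rho>) (B1 \<union> B2)"
      using sets by (intro finite_measure.finite_measure_mono prob_space.finite_measure prob_space_PiM
          measure_pmf.prob_space_axioms) auto
    also have "\<dots> \<le> measure (isr_space \<rho>) B1 + measure (isr_space \<rho>) B2"
      using sets by (rule measure_Un_le)
    also have "\<dots> \<le> 1 / 6 + 1 / 6"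
      unfolding B1_def B2_def using xy by (intro add_mono sk'(6)) auto
    finally show ?thesis
      by simp
  qed
  moreover have "finite (Msg \<times> (UNIV :: bool set))" "card (Msg \<times> (UNIV :: bool set)) \<le> 2 ^ Suc c"
    using sk'(1,2) by (auto simp: card_cartesian_product)
  moreover have "enc' x u \<in> Msg \<times> UNIV" for x u
    using sk'(3) by (simp add: enc'_def)
  moreover have "\<exists>K. finite K \<and> depends_on (enc' x) K" for x
    using sk'(4)[of x] unfolding enc'_def by (auto intro: depends_on_compose)
  moreover have "\<exists>K. finite K \<and> depends_on (dec' mp y) K" for mp y
  proof -
    obtain K K' where "finite K" "depends_on (dec (fst mp) y) K" "finite K'" "depends_on (dec (fst mp) (map Not y)) K'"
      using sk'(5) by metis
    then have "finite (K \<union> K')" "depends_on (dec' mp y) (K \<union> K')"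
      unfolding dec'_def
      using depends_on_compose2[where f = "dec (fst mp) y" and g = "dec (fst mp) (map Not y)"
          and h = "\<lambda>e e'. G (SOME d. guess (snd mp) y e e' d)"] by blast+
    then show ?thesis
      by blast
  qed
  ultimately show "ISR_cc \<rho> n f \<le> c + 2" "ISR_one_way_cc \<rho> n f \<le> c + 1"
    using ISR_cc_le[of "Msg \<times> (UNIV :: bool set)" "Suc c" enc' dec' n \<rho> f] by simp_all
qed

text \<open>After flipping, ones mark coordinates that cannot match. If both players have at most
  \<open>z\<close> ones, the distance is at most \<open>2 * z\<close>, so the sketch is exact and
  yields the size of the union. Otherwise fewer than \<open>n - z\<close> matches remain, where
  \<open>G\<close> equals \<open>G 0\<close>.\<close>

lemma ISR_cc_AND_le:
  assumes sk: "is_sketch \<rho> n (2 * z) c Msg enc dec"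
    and f: "\<And>x y. length x = n \<Longrightarrow> length y = n \<Longrightarrow> f x y = G (matches \<alpha> \<beta> x y)"
    and step: "\<And>l. l + z < n \<Longrightarrow> G l = G (Suc l)"
  shows "ISR_cc \<rho> n f \<le> c + z + 3" "ISR_one_way_cc \<rho> n f \<le> c + z + 2"
proof -
  define flip where "flip \<gamma> x = map (\<lambda>a. a \<noteq> \<gamma>) x" for \<gamma> :: bool and x
  define enc' where "enc' x u = (enc (flip \<alpha> x) u, min (card (ones (flip \<alpha> x))) (Suc z))" for x u
  define dec' where "dec' ma y v = (if snd ma \<le> z \<and> card (ones (flip \<beta> y)) \<le> z
      then G (n - (snd ma + card (ones (flip \<beta> y)) + dec (fst ma) (flip \<beta> y) v) div 2) else G 0)" for ma y v
  have sk': "finite Msg" "card Msg \<le> 2 ^ c" "\<And>x u. enc x u \<in> Msg" "\<And>x. \<exists>K. finite K \<and> depends_on (enc x) K"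
    "\<And>m y. \<exists>K. finite K \<and> depends_on (dec m y) K"
    "\<And>x y. length x = n \<Longrightarrow> length y = n \<Longrightarrow> measure (isr_space \<rho>)
      {w. dec (enc x (\<lambda>i. fst (w i))) y (\<lambda>i. snd (w i)) \<noteq> min (hamming x y) (Suc (2 * z))} \<le> 1 / 6"
    using sk by (auto simp: is_sketch_def)
  have G0: "G l = G 0" if "l + z \<le> n" for l
    using that by (induction l) (auto simp: step[symmetric])
  have good: "dec' (enc' x u) y v = f x y"
    if xy: "length x = n" "length y = n"
      and ok: "dec (enc (flip \<alpha> x) u) (flip \<beta> y) v = min (hamming (flip \<alpha> x) (flip \<beta> y)) (Suc (2 * z))" for x y u v
  proof -
    define U where "U = ones (flip \<alpha> x)"
    define V where "V = ones (flip \<beta> y)"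
    have fin: "finite U" "finite V"
      by (auto simp: U_def V_def ones_def)
    have "{i. i < n \<and> x ! i = \<alpha> \<and> y ! i = \<beta>} = {..<n} - (U \<union> V)"
      using xy by (auto simp: U_def V_def ones_def flip_def)
    moreover have "U \<union> V \<subseteq> {..<n}"
      using xy by (auto simp: U_def V_def ones_def flip_def)
    ultimately have matches: "matches \<alpha> \<beta> x y = n - card (U \<union> V)"
      using fin xy by (simp add: matches_def card_Diff_subset)
    have UV: "card (U \<union> V) \<le> n"
      using card_mono[OF _ \<open>U \<union> V \<subseteq> {..<n}\<close>] by simp
    have ham: "hamming (flip \<alpha> x) (flip \<beta> y) + card U + card V = 2 * card (U \<union> V)"
      unfolding U_def V_def using xy by (intro hamming_eq_card_sym_diff) (simp add: flip_def)
    have le: "card U \<le> card (U \<union> V)" "card V \<le> card (U \<union> V)" "card (U \<union> V) \<le> card U + card V"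
      using fin by (auto intro: card_mono card_Un_le)
    show ?thesis
    proof (cases "card U \<le> z \<and> card V \<le> z")
      case True
      then have "dec (enc (flip \<alpha> x) u) (flip \<beta> y) v = hamming (flip \<alpha> x) (flip \<beta> y)"
        using ok ham le by simp
      moreover have "(card U + card V + hamming (flip \<alpha> x) (flip \<beta> y)) div 2 = card (U \<union> V)"
        using ham by simp
      ultimately show ?thesis
        using True f[OF xy] matches by (simp add: dec'_def enc'_def U_def V_def)
    next
      case False
      then have "card (U \<union> V) \<ge> Suc z"
        using le by auto
      then have "G (matches \<alpha> \<beta> x y) = G 0"
        unfolding matches using UV by (intro G0) simp
      then show ?thesis
        using False f[OF xy] by (auto simp: dec'_def enc'_def U_def V_def)
    qed
  qed
  have "measure (isr_space \<rho>) {w. dec' (enc' x (\<lambda>i. fst (w i))) y (\<lambda>i. snd (w i)) \<noteq> f x y} \<le> 1 / 3"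
    if xy: "length x = n" "length y = n" for x y
  proof -
    define B1 where "B1 = {w. dec (enc (flip \<alpha> x) (\<lambda>i. fst (w i))) (flip \<beta> y) (\<lambda>i. snd (w i))
        \<noteq> min (hamming (flip \<alpha> x) (flip \<beta> y)) (Suc (2 * z))}"
    have "{w. dec' (enc' x (\<lambda>i. fst (w i))) y (\<lambda>i. snd (w i)) \<noteq> f x y} \<subseteq> B1"
      using good[OF xy] by (auto simp: B1_def)
    moreover have "B1 \<in> sets (isr_space \<rho>)"
      unfolding B1_def by (rule sets_sketch_error[OF sk])
    ultimately have "measure (isr_space \<rho>) {w. dec' (enc' x (\<lambda>i. fst (w i))) y (\<lambda>i. snd (w i)) \<noteq> f x y}
        \<le> measure (isr_space \<rho>) B1"
      by (intro finite_measure.finite_measure_mono prob_space.finite_measure prob_space_PiM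
          measure_pmf.prob_space_axioms)
    also have "\<dots> \<le> 1 / 6"
      unfolding B1_def using xy by (intro sk'(6)) (auto simp: flip_def)
    finally show ?thesis
      by simp
  qed
  moreover have "finite (Msg \<times> {..Suc z})" "card (Msg \<times> {..Suc z}) \<le> 2 ^ (c + z + 2)"
  proof -
    \<comment> \<open>The capped count takes \<open>z + 2\<close> values. Granting it
      \<open>z + 2\<close> bits is crude but only linear in \<open>z\<close>.\<close>
    have "card (Msg \<times> {..Suc z}) \<le> 2 ^ c * 2 ^ (z + 2)"
      unfolding card_cartesian_product using sk'(2) less_exp[of "z + 2"] by (intro mult_mono) auto
    then show "card (Msg \<times> {..Suc z}) \<le> 2 ^ (c + z + 2)"
      by (simp add: power_add)
  qed (use sk'(1) in auto)
  moreover have "enc' x u \<in> Msg \<times> {..Suc z}" for x u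
    using sk'(3) by (simp add: enc'_def)
  moreover have "\<exists>K. finite K \<and> depends_on (enc' x) K" for x
    using sk'(4)[of "flip \<alpha> x"] unfolding enc'_def by (auto intro: depends_on_compose)
  moreover have "\<exists>K. finite K \<and> depends_on (dec' ma y) K" for ma y
  proof -
    obtain K where "finite K" "depends_on (dec (fst ma) (flip \<beta> y)) K"
      using sk'(5) by metis
    then show ?thesis
      using depends_on_compose[where f = "dec (fst ma) (flip \<beta> y)" and K = K
          and g = "\<lambda>e. if snd ma \<le> z \<and> card (ones (flip \<beta> y)) \<le> z
            then G (n - (snd ma + card (ones (flip \<beta> y)) + e) div 2) else G 0"]
      unfolding dec'_def by blast
  qed
  ultimately show "ISR_cc \<rho> n f \<le> c + z + 3" "ISR_one_way_cc \<rho> n f \<le> c + z + 2"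
    using ISR_cc_le[of "Msg \<times> {..Suc z}" "c + z + 2" enc' dec' n \<rho> f] by simp_all
qed

text \<open>The number of samples is quadratic in \<open>r + 1\<close>, each sample takes
  logarithmically many bits, and all constants depend on \<open>\<rho>\<close> alone.\<close>

lemma hamming_sketch_cost:
  assumes \<rho>: "0 < \<rho>" "\<rho> \<le> 1"
  shows "\<exists>C\<ge>0. \<forall>n r. \<exists>c (Msg :: int list set) enc dec. is_sketch \<rho> n r c Msg enc dec \<and>
    real c \<le> C * (real r + 1)\<^sup>2 * log 2 (real r + 2)"
proof -
  define a where "a = log 2 (133121 / \<rho>\<^sup>2)"
  have \<rho>2: "0 < \<rho>\<^sup>2" "\<rho>\<^sup>2 \<le> 1"
    using \<rho> by (auto simp: power_le_one)
  have a: "a \<ge> 0"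
    unfolding a_def using \<rho>2 by (simp add: pos_le_divide_eq)
  have ceil: "real (nat \<lceil>t\<rceil>) \<le> t + 1" if "t \<ge> 0" for t :: real
  proof -
    have "real (nat \<lceil>t\<rceil>) = real_of_int \<lceil>t\<rceil>"
      using that by simp
    then show ?thesis
      using of_int_ceiling_le_add_one[of t] by (simp only:)
  qed
  \<comment> \<open>73729 = 64 * 1152 + 1 bounds \<open>T\<close>, with 1 for the ceiling. In
    \<open>a + 3\<close>, \<open>a\<close> is the logarithm of the constant factor, 2 comes from the
    square inside the logarithm and 1 from the ceiling.\<close>
  define C where "C = (a + 3) * (73729 / \<rho>\<^sup>2)"
  have "\<exists>c (Msg :: int list set) enc dec. is_sketch \<rho> n r c Msg enc dec \<and>
      real c \<le> C * (real r + 1)\<^sup>2 * log 2 (real r + 2)" for n r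
  proof -
    define R where "R = real r + 1"
    have R: "R \<ge> 1"
      by (simp add: R_def)
    define \<kappa> where "\<kappa> = \<rho> / (8 * (real r + 1))"
    have inv: "t / \<kappa>\<^sup>2 = 64 * t * R\<^sup>2 / \<rho>\<^sup>2" for t
    proof -
      have "\<kappa>\<^sup>2 = \<rho>\<^sup>2 / (64 * R\<^sup>2)"
        unfolding \<kappa>_def R_def[symmetric] by (simp add: power_divide power_mult_distrib)
      then show ?thesis
        by simp
    qed
    define X where "X = 2 * (1040 / \<kappa>\<^sup>2) + 1"
    define b where "b = nat \<lceil>log 2 X\<rceil>"
    define T where "T = nat \<lceil>1152 / \<kappa>\<^sup>2\<rceil>"
    have X1: "X \<ge> 1"
      by (simp add: X_def)
    have "X = 2 powr log 2 X"
      using X1 by simp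
    also have "\<dots> \<le> 2 powr real b"
      by (intro powr_mono) (auto simp: b_def real_nat_ceiling_ge)
    also have "\<dots> = 2 ^ b"
      by (simp add: powr_realpow)
    finally have "2 * (1040 / \<kappa>\<^sup>2) + 1 \<le> 2 ^ b"
      by (simp only: X_def)
    then obtain Msg :: "int list set" and enc dec where sk: "is_sketch \<rho> n r (b * T) Msg enc dec"
      using hamming_sketch_exists[OF \<rho>, of r b n] unfolding \<kappa>_def T_def by blast
    have lg: "log 2 (real r + 2) \<ge> 1"
      by (simp add: le_log_iff)
    have R1: "1 \<le> R\<^sup>2 / \<rho>\<^sup>2"
      using R \<rho>2 by (simp add: pos_le_divide_eq order_trans[OF \<rho>2(2)])
    have "X = 133120 * (R\<^sup>2 / \<rho>\<^sup>2) + 1"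
      unfolding X_def inv by simp
    also have "\<dots> \<le> 133121 * (R\<^sup>2 / \<rho>\<^sup>2)"
      using R1 by simp
    also have "\<dots> \<le> 133121 * ((real r + 2)\<^sup>2 / \<rho>\<^sup>2)"
      using \<rho>2 by (intro mult_left_mono divide_right_mono power_mono) (auto simp: R_def)
    also have "\<dots> = (133121 / \<rho>\<^sup>2) * (real r + 2)\<^sup>2"
      by simp
    finally have "log 2 X \<le> log 2 ((133121 / \<rho>\<^sup>2) * (real r + 2)\<^sup>2)"
      using X1 by simp
    also have "\<dots> = a + 2 * log 2 (real r + 2)"
      using \<rho>2 unfolding a_def by (subst log_mult_pos) (auto simp: log_nat_power)
    finally have "log 2 X + 1 \<le> a * 1 + 2 * log 2 (real r + 2) + 1"
      by simp
    also have "\<dots> \<le> a * log 2 (real r + 2) + 2 * log 2 (real r + 2) + log 2 (real r + 2)"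
      using lg a by (intro add_mono mult_left_mono) auto
    also have "\<dots> = (a + 3) * log 2 (real r + 2)"
      by (simp add: algebra_simps)
    finally have b: "real b \<le> (a + 3) * log 2 (real r + 2)"
      using X1 unfolding b_def by (intro order_trans[OF ceil]) simp_all
    have "real T \<le> 1152 / \<kappa>\<^sup>2 + 1"
      unfolding T_def by (rule ceil) simp
    also have "\<dots> \<le> 73729 * (R\<^sup>2 / \<rho>\<^sup>2)"
      using R1 unfolding inv by simp
    finally have T: "real T \<le> 73729 * (R\<^sup>2 / \<rho>\<^sup>2)" .
    have "real (b * T) \<le> ((a + 3) * log 2 (real r + 2)) * (73729 * (R\<^sup>2 / \<rho>\<^sup>2))"
      unfolding of_nat_mult using b T a lg by (intro mult_mono) auto
    also have "\<dots> = C * (real r + 1)\<^sup>2 * log 2 (real r + 2)"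
      by (simp add: C_def R_def)
    finally show ?thesis
      using sk by blast
  qed
  moreover have "C \<ge> 0"
    using a \<rho>2 by (simp add: C_def)
  ultimately show ?thesis
    by blast
qed

theorem theorem4p12:
  fixes \<rho> :: real
  assumes "0 < \<rho>" and "\<rho> < 1"
  shows "\<exists>(C::real) (d::nat). \<forall>n f k. strongly_perm_invariant n f \<and> R_cc n f = k \<longrightarrow>
           real (ISR_cc \<rho> n f) \<le> C * real k ^ 2 * log 2 (real k + 2) ^ d \<and>
           real (ISR_one_way_cc \<rho> n f) \<le> C * real k ^ 3 * log 2 (real k + 2) ^ d"
proof -
  obtain C where C: "C \<ge> 0" and sketch: "\<And>n r. \<exists>c (Msg :: int list set) enc dec. is_sketch \<rho> n r c Msg enc dec \<and>
      real c \<le> C * (real r + 1)\<^sup>2 * log 2 (real r + 2)"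
    using hamming_sketch_cost[of \<rho>] assms by (metis less_imp_le)
  \<comment> \<open>For \<open>k \<ge> 1\<close>, \<open>1153 * k\<close> bounds
    \<open>2 * (576 * k) + 1\<close>, 12 comes from the logarithm, and 579 absorbs
    \<open>576 * k + 3\<close>.\<close>
  define C' where "C' = C * (1153\<^sup>2 * 12) + 579"
  have "real (ISR_cc \<rho> n f) \<le> C' * real k ^ 2 * log 2 (real k + 2) ^ 1 \<and>
      real (ISR_one_way_cc \<rho> n f) \<le> C' * real k ^ 3 * log 2 (real k + 2) ^ 1"
    if inv: "strongly_perm_invariant n f" and k: "R_cc n f = k" for n f k
  proof (cases "k = 0")
    case True
    then obtain b where "\<And>x y. length x = n \<Longrightarrow> length y = n \<Longrightarrow> f x y = b"
      using constant_if_R_cc_eq_0[of n f] k by metis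
    then show ?thesis
      using ISR_cc_constant[of n f b \<rho>] True by simp
  next
    case False
    then have k1: "real k \<ge> 1"
      by simp
    obtain P where P: "computes public_coins n f P" "cost P = k"
      using R_cc_attained[of n f] k by auto
    \<comment> \<open>One radius for both cases: it marks the ends outside which XOR has no jumps,
      and it is twice the bound \<open>z = 576 * k\<close> of the AND case.\<close>
    obtain c and Msg :: "int list set" and enc dec where sk: "is_sketch \<rho> n (2 * (576 * k)) c Msg enc dec"
      and c: "real c \<le> C * (real (2 * (576 * k)) + 1)\<^sup>2 * log 2 (real (2 * (576 * k)) + 2)"
      using sketch by blast
    define S where "S = (real k)\<^sup>2 * log 2 (real k + 2)"
    have lg: "log 2 (real k + 2) \<ge> 1"
      by (simp add: le_log_iff)
    have "real k * 1 * 1 \<le> real k * real k * log 2 (real k + 2)"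
      using k1 lg by (intro mult_mono) auto
    then have kS: "real k \<le> S"
      by (simp add: S_def power2_eq_square)
    have "log 2 (real (2 * (576 * k)) + 2) \<le> log 2 (2 ^ 11 * (real k + 2))"
      by (intro log_mono) auto
    also have "\<dots> = 11 + log 2 (real k + 2)"
      by (subst log_mult_pos) (auto simp: log_nat_power simp del: power_numeral)
    also have "\<dots> \<le> 12 * log 2 (real k + 2)"
      using lg by simp
    finally have "C * (real (2 * (576 * k)) + 1)\<^sup>2 * log 2 (real (2 * (576 * k)) + 2)
        \<le> C * (1153 * real k)\<^sup>2 * (12 * log 2 (real k + 2))"
      using C k1 by (intro mult_mono mult_left_mono power_mono) auto
    then have cS: "real c \<le> C * (1153\<^sup>2 * 12) * S"
      using c by (simp add: S_def power_mult_distrib)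
    have "ISR_cc \<rho> n f \<le> c + 576 * k + 3 \<and> ISR_one_way_cc \<rho> n f \<le> c + 576 * k + 3"
      using inv
    proof (cases rule: strongly_perm_invariant_cases)
      case (left F)
      have "ISR_cc \<rho> n f \<le> Suc 1" "ISR_one_way_cc \<rho> n f \<le> 1"
        by (rule ISR_cc_le[of "UNIV :: bool set" 1 "\<lambda>x _. F x" "\<lambda>m _ _. m"];
            use left in \<open>auto simp: depends_on_def intro: exI[of _ "{}"]\<close>)+
      then show ?thesis
        by simp
    next
      case (right F)
      have "ISR_cc \<rho> n f \<le> Suc 1" "ISR_one_way_cc \<rho> n f \<le> 1"
        by (rule ISR_cc_le[of "UNIV :: bool set" 1 "\<lambda>_ _. True" "\<lambda>_ y _. F y"];
            use right in \<open>auto simp: depends_on_def intro: exI[of _ "{}"]\<close>)+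
      then show ?thesis
        by simp
    next
      case (xor G)
      \<comment> \<open>A jump here would leave room for \<open>576 * k + 1\<close> elements, one
        more than the lower bound permits.\<close>
      have step: "G i = G (i + 2)" if "2 * (576 * k) < i" "i + 2 + 2 * (576 * k) < n" for i
        using XOR_jump_bound[OF P(1) xor, of i "Suc (576 * k)"] that P(2) by fastforce
      have "ISR_cc \<rho> n f \<le> c + 2" "ISR_one_way_cc \<rho> n f \<le> c + 1"
        by (rule ISR_cc_XOR_le[where G = G, OF sk xor step]; assumption)+
      then show ?thesis
        by simp
    next
      case (conj G \<alpha> \<beta>)
      have step: "G l = G (Suc l)" if "l + 576 * k < n" for l
        using AND_jump_bound[OF P(1) conj, of l] that P(2) by fastforce
      have "ISR_cc \<rho> n f \<le> c + 576 * k + 3" "ISR_one_way_cc \<rho> n f \<le> c + 576 * k + 2"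
        by (rule ISR_cc_AND_le[where G = G, OF sk conj step]; assumption)+
      then show ?thesis
        by simp
    qed
    moreover have "real (c + 576 * k + 3) \<le> C' * S"
      using cS kS k1 by (simp add: C'_def algebra_simps)
    ultimately have le: "real (ISR_cc \<rho> n f) \<le> C' * S" "real (ISR_one_way_cc \<rho> n f) \<le> C' * S"
      by linarith+
    \<comment> \<open>The one-way protocol already has quadratic cost up to the logarithm;
      \<open>k \<ge> 1\<close> weakens this to the cubic bound.\<close>
    have "C' * S * 1 \<le> C' * S * real k"
      using k1 C kS by (intro mult_left_mono) (auto simp: C'_def)
    then show ?thesis
      using le by (simp add: S_def power2_eq_square power3_eq_cube mult_ac)
  qed
  then show ?thesis
    by blast
qed

end
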